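(* Let $d\in[1,+\infty]$. Suppose that a family $(\varphi_{s,t})_{0\le s\le t}$ of holomorphic self-maps of $\mathbb{D}$ satisfies $\varphi_{s,s}=\mathrm{id}_{\mathbb{D}}$ for all $s\ge0$ and $\varphi_{s,t}=\varphi_{s,u}\circ\varphi_{u,t}$ for all $0\le s\le u\le t<+\infty$. Then the following conditions are equivalent: (i) for each $T>0$ there exist two distinct points $\zeta_j\in\mathbb{D}$, $j=1,2$, and a non-negative function $k_T\in L^d([0,T],\mathbb{R})$ such that for $j=1,2$, $$|\varphi_{s,t}(\zeta_j)-\varphi_{s,u}(\zeta_j)|\le\int_u^tk_T(\xi)\,d\xi\quad\text{whenever }0\le s\le u\le t\le T;$$ (ii) $(\varphi_{s,t})$ is a reverse evolution family of order $d$, i.e. for any $z\in\mathbb{D}$ and any $T>0$ there exists a non-negative function $k_{z,T}\in L^d([0,T],\mathbb{R})$ such that $|\varphi_{s,u}(z)-\varphi_{s,t}(z)|\le\int_u^tk_{z,T}(\xi)\,d\xi$ whenever $0\le s\le u\le t\le T$; (iii) for any $T>0$ and any compact set $K\subset\mathbb{D}$ there exists a non-negative function $k_{K,T}\in L^d([0,T],\mathbb{R})$ such that for all $z\in K$, $$|\varphi_{s,t}(z)-\varphi_{s,u}(z)|\le\int_u^tk_{K,T}(\xi)\,d\xi\quad\text{whenever }0\le s\le u\le t\le T;$$ (iv) for any $T>0$ there exists an evolution family $(\varphi^T_{s,t})$ of order $d$ such that $\varphi_{s,t}=\varphi^T_{T-t,T-s}$ for all $0\le s\le t\le T$; (v)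 for any $T>0$ and any compact set $K\subset\mathbb{D}$ there exists a non-negative function $k_{K,T}\in L^d([0,T],\mathbb{R})$ such that for all $z\in K$, $$|\varphi_{s,t}(z)-\varphi_{u,t}(z)|\le\int_s^uk_{K,T}(\xi)\,d\xi\quad\text{whenever }0\le s\le u\le t\le T.$$ In particular, every element of any reverse evolution family is a univalent function in $\mathbb{D}$.
   Context: $\mathbb{D}=\{z\in\mathbb{C}:|z|<1\}$. Reverse evolution family of order $d\in[1,+\infty]$: a family $(\varphi_{s,t})_{0\le s\le t}$ of holomorphic self-maps of $\mathbb{D}$ such that (REF1) $\varphi_{s,s}=\mathrm{id}_{\mathbb{D}}$ for all $s\ge0$; (REF2) $\varphi_{s,t}=\varphi_{s,u}\circ\varphi_{u,t}$ for all $0\le s\le u\le t<+\infty$; (REF3) the condition written out in (ii) of the claim. Evolution family of order $d\in[1,+\infty]$: a family $(\psi_{s,t})_{0\le s\le t}$ of holomorphic self-maps of $\mathbb{D}$ such that (EF1) $\psi_{s,s}=\mathrm{id}_{\mathbb{D}}$ for all $s\ge0$; (EF2) $\psi_{s,t}=\psi_{u,t}\circ\psi_{s,u}$ whenever $0\le s\le u\le t<+\infty$; (EF3) for every $z\in\mathbb{D}$ and every $T>0$ there exists a non-negative function $k_{z,T}\in L^d([0,T],\mathbb{R})$ such that $|\psi_{s,u}(z)-\psi_{s,t}(z)|\le\int_u^tk_{z,T}(\xi)\,d\xi$ whenever $0\le s\le u\le t\le T$. *)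

theory Defs
  imports "HOL-Analysis.Analysis"
begin

abbreviation unit_disc :: "complex set" where
  "unit_disc \<equiv> ball 0 1"

text \<open>The non-negative elements of the space \<open>L\<close> of exponent \<open>d\<close> on \<open>[0, T]\<close>, for
  \<open>1 \<le> d \<le> \<infinity>\<close>, with respect to Lebesgue measure. They are represented by functions rather than by
  classes modulo null sets, and their values outside \<open>[0, T]\<close> are unconstrained.\<close>

definition nonneg_Ld :: "ereal \<Rightarrow> real \<Rightarrow> (real \<Rightarrow> real) set" where
  "nonneg_Ld d T = {k. k \<in> borel_measurable (lebesgue_on {0..T}) \<and> (\<forall>x\<in>{0..T}. 0 \<le> k x) \<and>
     (if d = \<infinity> then \<exists>C. AE x in lebesgue_on {0..T}. \<bar>k x\<bar> \<le> C
      else integrable (lebesgue_on {0..T}) (\<lambda>x. \<bar>k x\<bar> powr real_of_ereal d))}"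

text \<open>Families indexed by \<open>0 \<le> s \<le> t\<close> are functions of two real arguments: the members with other
  indices, and all values outside the disc, are irrelevant. Hence identities between self-maps of the
  disc are stated pointwise on the disc.\<close>

definition disc_self_map_family :: "(real \<Rightarrow> real \<Rightarrow> complex \<Rightarrow> complex) \<Rightarrow> bool" where
  "disc_self_map_family \<phi> \<longleftrightarrow>
     (\<forall>s t. 0 \<le> s \<longrightarrow> s \<le> t \<longrightarrow>
        \<phi> s t holomorphic_on unit_disc \<and> \<phi> s t ` unit_disc \<subseteq> unit_disc)"

definition reverse_evolution_family :: "ereal \<Rightarrow> (real \<Rightarrow> real \<Rightarrow> complex \<Rightarrow> complex) \<Rightarrow> bool" where
  "reverse_evolution_family d \<phi> \<longleftrightarrow>
     disc_self_map_family \<phi> \<and>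
     (\<forall>s\<ge>0. \<forall>z\<in>unit_disc. \<phi> s s z = z) \<and>
     (\<forall>s u t. 0 \<le> s \<longrightarrow> s \<le> u \<longrightarrow> u \<le> t \<longrightarrow> (\<forall>z\<in>unit_disc. \<phi> s t z = \<phi> s u (\<phi> u t z))) \<and>
     (\<forall>z\<in>unit_disc. \<forall>T>0. \<exists>k\<in>nonneg_Ld d T.
        \<forall>s u t. 0 \<le> s \<longrightarrow> s \<le> u \<longrightarrow> u \<le> t \<longrightarrow> t \<le> T \<longrightarrow>
          norm (\<phi> s u z - \<phi> s t z) \<le> (LINT \<xi>|lebesgue_on {u..t}. k \<xi>))"

definition evolution_family :: "ereal \<Rightarrow> (real \<Rightarrow> real \<Rightarrow> complex \<Rightarrow> complex) \<Rightarrow> bool" where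
  "evolution_family d \<psi> \<longleftrightarrow>
     disc_self_map_family \<psi> \<and>
     (\<forall>s\<ge>0. \<forall>z\<in>unit_disc. \<psi> s s z = z) \<and>
     (\<forall>s u t. 0 \<le> s \<longrightarrow> s \<le> u \<longrightarrow> u \<le> t \<longrightarrow> (\<forall>z\<in>unit_disc. \<psi> s t z = \<psi> u t (\<psi> s u z))) \<and>
     (\<forall>z\<in>unit_disc. \<forall>T>0. \<exists>k\<in>nonneg_Ld d T.
        \<forall>s u t. 0 \<le> s \<longrightarrow> s \<le> u \<longrightarrow> u \<le> t \<longrightarrow> t \<le> T \<longrightarrow>
          norm (\<psi> s u z - \<psi> s t z) \<le> (LINT \<xi>|lebesgue_on {u..t}. k \<xi>))"

end

theory Submission
  imports Defs "HOL-Complex_Analysis.Riemann_Mapping"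
begin

text \<open>All conditions say in different ways that the maps \<open>\<phi> s t\<close> move points of the disc by no more
  than the integral over \<open>[s, t]\<close> of one function of class \<open>L\<close> with exponent \<open>d\<close>. The proof takes the
  locally uniform form of this as a hub (\<open>displacement_controlled\<close>): on each disc of radius
  \<open>r < 1\<close>, the displacement \<open>\<phi> s t z - z\<close> is bounded by \<open>\<integral>\<^sub>s\<^sup>t k\<close> with \<open>k\<close> depending on \<open>r\<close> and the
  horizon \<open>T\<close> only.

  Each condition contains such a bound at two distinct points: put \<open>u = s\<close> or \<open>u = t\<close> in it, where one
  of the two maps is the identity. That two points suffice is a quantitative form of the fact that a
  self-map of the disc with two fixed points is the identity (\<open>two_point_displacement_bound\<close>): after
  Moebius transformations the self-map is \<open>z \<mapsto> z * h z\<close> with \<open>|h| \<le> 1\<close>, and by a Harnack inequality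
  \<open>1 - h\<close> is small on compact sets as soon as it is small at one point.

  Conversely, the functional equation turns displacements into increments. In the second parameter,
  \<open>\<phi> s t z - \<phi> s u z\<close> is the increment of \<open>\<phi> s u\<close> between \<open>\<phi> u t z\<close> and \<open>z\<close>, and the Schwarz-Pick
  inequality bounds the Lipschitz constant of \<open>\<phi> s u\<close> by a function of \<open>|z|\<close> alone. In the first
  parameter, \<open>\<phi> s t z - \<phi> u t z\<close> is the displacement of \<open>\<phi> u t z\<close> under \<open>\<phi> s u\<close>; here the
  points \<open>\<phi> u t z\<close> must stay in a compact part of the disc, which holds over short time intervals because
  the origin moves little, and then over \<open>[0, T]\<close> by composition (\<open>boundary_distance_bound\<close>).
  The evolution families are obtained by reversing time, which exchanges the parameters.

  Injectivity: over a short time the flow is so close to the identity on a compact part of the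
  disc that it is injective there. Hence two trajectories that stay in this compact part and are
  distinct at time \<open>t\<close> can never meet at an earlier time (\<open>flow_inj_on\<close>).\<close>

section \<open>Control functions in \<open>L\<close> of exponent \<open>d\<close>\<close>

lemma nonneg_Ld_finite_iff:
  assumes "d \<noteq> \<infinity>"
  shows "k \<in> nonneg_Ld d T \<longleftrightarrow> k \<in> borel_measurable (lebesgue_on {0..T}) \<and> (\<forall>x\<in>{0..T}. 0 \<le> k x) \<and>
     integrable (lebesgue_on {0..T}) (\<lambda>x. \<bar>k x\<bar> powr real_of_ereal d)"
  using assms by (simp add: nonneg_Ld_def)

lemma const_in_nonneg_Ld:
  assumes "0 \<le> c"
  shows "(\<lambda>x. c) \<in> nonneg_Ld d T"
  using assms by (auto simp: nonneg_Ld_def)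

lemma one_le_real_of_ereal:
  fixes d :: ereal
  assumes "1 \<le> d" "d \<noteq> \<infinity>"
  shows "1 \<le> real_of_ereal d"
  using assms by (cases d) (auto simp: one_ereal_def)

text \<open>Gives the inclusion of the space of exponent \<open>p\<close> in that of exponent \<open>1\<close> on sets of finite measure.\<close>

lemma le_one_plus_powr:
  fixes x p :: real
  assumes "0 \<le> x" "1 \<le> p"
  shows "x \<le> 1 + x powr p"
proof (cases "x \<le> 1")
  case True then show ?thesis by (smt (verit) powr_ge_zero)
next
  case False
  then have "x powr 1 \<le> x powr p" using assms by (intro powr_mono) auto
  then show ?thesis using assms False by simp
qed

lemma nonneg_Ld_integrable:
  assumes d: "1 \<le> d" and k: "k \<in> nonneg_Ld d T"
  shows "integrable (lebesgue_on {0..T}) k"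
proof (cases "d = \<infinity>")
  case True
  then obtain C where "AE x in lebesgue_on {0..T}. \<bar>k x\<bar> \<le> C"
    using k by (auto simp: nonneg_Ld_def)
  then show ?thesis using k 
    by (intro Bochner_Integration.integrable_bound[of _ "\<lambda>x. C" k])
      (auto simp: nonneg_Ld_def elim!: eventually_mono)
next
  case False
  have "integrable (lebesgue_on {0..T}) (\<lambda>x. 1 + \<bar>k x\<bar> powr real_of_ereal d)"
    using k False by (intro Bochner_Integration.integrable_add) (auto simp: nonneg_Ld_finite_iff)
  then show ?thesis
    using k False le_one_plus_powr[OF abs_ge_zero one_le_real_of_ereal[OF d False]] 
    by (elim Bochner_Integration.integrable_bound) (auto simp: nonneg_Ld_finite_iff)
qed

lemma nonneg_Ld_integrable_subinterval:
  assumes "1 \<le> d" "k \<in> nonneg_Ld d T" "0 \<le> u" "t \<le> T"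
  shows "integrable (lebesgue_on {u..t}) k"
  by (rule integrable_subinterval[OF nonneg_Ld_integrable[OF assms(1,2)]]) (use assms in auto)

lemma nonneg_Ld_integral_nonneg:
  assumes "k \<in> nonneg_Ld d T" "0 \<le> u" "t \<le> T"
  shows "0 \<le> (LINT \<xi>|lebesgue_on {u..t}. k \<xi>)"
  using assms by (intro integral_nonneg_AE AE_I2) (auto simp: nonneg_Ld_def)

lemma nonneg_Ld_integral_mono:
  assumes "1 \<le> d" "k \<in> nonneg_Ld d T" "m \<in> nonneg_Ld d T" "0 \<le> u" "t \<le> T" "\<And>x. k x \<le> m x"
  shows "(LINT \<xi>|lebesgue_on {u..t}. k \<xi>) \<le> (LINT \<xi>|lebesgue_on {u..t}. m \<xi>)"
  using assms by (intro integral_mono nonneg_Ld_integrable_subinterval) auto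

lemma nonneg_Ld_scale:
  assumes "0 \<le> c" "k \<in> nonneg_Ld d T"
  shows "(\<lambda>x. c * k x) \<in> nonneg_Ld d T"
proof (cases "d = \<infinity>")
  case True
  then obtain C where "AE x in lebesgue_on {0..T}. \<bar>k x\<bar> \<le> C"
    using assms by (auto simp: nonneg_Ld_def)
  then have "AE x in lebesgue_on {0..T}. \<bar>c * k x\<bar> \<le> c * C"
    by eventually_elim (use assms in \<open>auto simp: abs_mult intro: mult_left_mono\<close>)
  then show ?thesis using assms True by (auto simp: nonneg_Ld_def)
next
  case False
  then show ?thesis using assms by (auto simp: nonneg_Ld_finite_iff abs_mult powr_mult)
qed

lemma powr_max:
  fixes x y p :: real
  assumes "0 \<le> x" "0 \<le> y" "0 \<le> p"
  shows "max x y powr p = max (x powr p) (y powr p)"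
  using assms by (metis max.absorb1 max.absorb2 linear powr_mono2)

text \<open>The maximum serves as a common majorant of two control functions. Unlike for the sum,
  its power is the maximum of the powers, so no convexity inequality is involved.\<close>

lemma nonneg_Ld_max:
  assumes "1 \<le> d" "k \<in> nonneg_Ld d T" "m \<in> nonneg_Ld d T"
  shows "(\<lambda>x. max (k x) (m x)) \<in> nonneg_Ld d T"
proof (cases "d = \<infinity>")
  case True
  then obtain C D where "AE x in lebesgue_on {0..T}. \<bar>k x\<bar> \<le> C" "AE x in lebesgue_on {0..T}. \<bar>m x\<bar> \<le> D"
    using assms by (auto simp: nonneg_Ld_def)
  then have "AE x in lebesgue_on {0..T}. \<bar>max (k x) (m x)\<bar> \<le> max C D"
    by eventually_elim auto
  then show ?thesis using assms True by (auto simp: nonneg_Ld_def max.coboundedI1)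
next
  case False
  let ?p = "real_of_ereal d"
  have "integrable (lebesgue_on {0..T}) (\<lambda>x. max (\<bar>k x\<bar> powr ?p) (\<bar>m x\<bar> powr ?p))"
    using assms False by (intro integrable_max) (auto simp: nonneg_Ld_finite_iff)
  also have "?this \<longleftrightarrow> integrable (lebesgue_on {0..T}) (\<lambda>x. \<bar>max (k x) (m x)\<bar> powr ?p)"
    using assms False one_le_real_of_ereal[of d]
    by (intro Bochner_Integration.integrable_cong) (auto simp: nonneg_Ld_finite_iff powr_max[symmetric] max.coboundedI1)
  finally show ?thesis using assms False by (auto simp: nonneg_Ld_finite_iff max.coboundedI1)
qed

lemma integrable_restrict_lebesgue_on:
  fixes f :: "real \<Rightarrow> real"
  assumes "integrable lebesgue f"
  shows "integrable (lebesgue_on {a..b}) f"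
proof -
  have "integrable lebesgue (\<lambda>x. indicat_real {a..b} x *\<^sub>R f x)"
    using assms by (intro integrable_mult_indicator) auto
  then show ?thesis by (subst integrable_restrict_space) auto
qed

text \<open>The control functions for a family run backwards from time \<open>T\<close> and stopped at time \<open>0\<close>, on a
  horizon \<open>T'\<close> that may exceed \<open>T\<close>: the reflection of \<open>k\<close>, extended by zero. For \<open>d = \<infinity>\<close>
  an essential bound of \<open>k\<close> does the same job, because \<open>t \<mapsto> max 0 (T - t)\<close> does not increase lengths.\<close>

lemma nonneg_Ld_reflect:
  assumes d: "1 \<le> d" and k: "k \<in> nonneg_Ld d T"
  obtains m where "m \<in> nonneg_Ld d T'"
    "\<And>u t. 0 \<le> u \<Longrightarrow> u \<le> t \<Longrightarrow> t \<le> T' \<Longrightarrow>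
       (LINT \<xi>|lebesgue_on {max 0 (T - t)..max 0 (T - u)}. k \<xi>) \<le> (LINT \<xi>|lebesgue_on {u..t}. m \<xi>)"
proof -
  \<comment> \<open>For \<open>u > T\<close> the interval on the left shrinks to the point \<open>0\<close>.\<close>
  have degenerate: "(LINT \<xi>|lebesgue_on {max 0 (T - t)..max 0 (T - u)}. k \<xi>) = 0" if "T < u" "u \<le> t" for u t
    using that by (intro integral_eq_zero_null_sets) (auto simp: null_sets_def)
  show thesis
  proof (cases "d = \<infinity>")
    case True
    then obtain C where C: "AE x in lebesgue_on {0..T}. \<bar>k x\<bar> \<le> C"
      using k by (auto simp: nonneg_Ld_def)
    show thesis
    proof (rule that)
      show const: "(\<lambda>x. max C 0) \<in> nonneg_Ld d T'" by (rule const_in_nonneg_Ld) auto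
      fix u t :: real assume ut: "0 \<le> u" "u \<le> t" "t \<le> T'"
      show "(LINT \<xi>|lebesgue_on {max 0 (T - t)..max 0 (T - u)}. k \<xi>) \<le> (LINT \<xi>|lebesgue_on {u..t}. max C 0)"
      proof (cases "T < u")
        case True
        with degenerate ut nonneg_Ld_integral_nonneg[OF const] show ?thesis by simp
      next
        case False
        let ?S = "{max 0 (T - t)..max 0 (T - u)}"
        have "AE x in lebesgue. x \<in> {0..T} \<longrightarrow> \<bar>k x\<bar> \<le> C"
          using C by (subst (asm) AE_restrict_space_iff) auto
        then have "AE x in lebesgue. x \<in> ?S \<longrightarrow> k x \<le> max C 0"
          by eventually_elim (use ut False in auto)
        then have "AE x in lebesgue_on ?S. k x \<le> max C 0"
          by (subst AE_restrict_space_iff) auto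
        then have "(LINT \<xi>|lebesgue_on ?S. k \<xi>) \<le> (LINT \<xi>|lebesgue_on ?S. max C 0)"
          using ut False by (intro integral_mono_AE nonneg_Ld_integrable_subinterval[OF d k]) auto
        also have "\<dots> = (max 0 (T - u) - max 0 (T - t)) * max C 0"
          using ut False by (simp add: measure_restrict_space)
        also have "\<dots> \<le> (t - u) * max C 0"
          using ut by (intro mult_right_mono) auto
        also have "\<dots> = (LINT \<xi>|lebesgue_on {u..t}. max C 0)"
          using ut by (simp add: measure_restrict_space)
        finally show ?thesis .
      qed
    qed
  next
    case False
    let ?p = "real_of_ereal d"
    define K where "K x = indicat_real {0..T} x * k x" for x
    define m where "m x = K (T + (-1) * x)" for x
    have K0: "0 \<le> K x" for x using k by (auto simp: K_def nonneg_Ld_def indicator_def)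
    have "integrable lebesgue K"
      using nonneg_Ld_integrable[OF d k] unfolding K_def
      by (subst (asm) integrable_restrict_space) auto
    then have m1: "integrable lebesgue m"
      unfolding m_def by (intro lebesgue_integrable_real_affine) auto
    have "integrable lebesgue (\<lambda>x. indicat_real {0..T} x *\<^sub>R \<bar>k x\<bar> powr ?p)"
      using k False by (subst integrable_restrict_space[symmetric]) (auto simp: nonneg_Ld_finite_iff)
    also have "(\<lambda>x. indicat_real {0..T} x *\<^sub>R \<bar>k x\<bar> powr ?p) = (\<lambda>x. \<bar>K x\<bar> powr ?p)"
      by (auto simp: K_def indicator_def)
    finally have m2: "integrable lebesgue (\<lambda>x. \<bar>m x\<bar> powr ?p)"
      unfolding m_def by (rule lebesgue_integrable_real_affine) auto
    show thesis
    proof (rule that)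
      have "m \<in> borel_measurable (lebesgue_on {0..T'})"
        using integrable_restrict_lebesgue_on[OF m1] by auto
      then show mL: "m \<in> nonneg_Ld d T'"
        using integrable_restrict_lebesgue_on[OF m2] K0 False by (auto simp: nonneg_Ld_finite_iff m_def)
      fix u t :: real assume ut: "0 \<le> u" "u \<le> t" "t \<le> T'"
      show "(LINT \<xi>|lebesgue_on {max 0 (T - t)..max 0 (T - u)}. k \<xi>) \<le> (LINT \<xi>|lebesgue_on {u..t}. m \<xi>)"
      proof (cases "T < u")
        case True
        with degenerate ut nonneg_Ld_integral_nonneg[OF mL] show ?thesis by simp
      next
        case False
        have "(LINT \<xi>|lebesgue_on {max 0 (T - t)..max 0 (T - u)}. k \<xi>) =
            (LINT x|lebesgue. indicat_real {max 0 (T - t)..max 0 (T - u)} x *\<^sub>R k x)"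
          by (subst integral_restrict_space) auto
        also have "\<dots> = (LINT x|lebesgue. indicat_real {T - t..T - u} x *\<^sub>R K x)"
          by (intro Bochner_Integration.integral_cong)
             (use ut False in \<open>auto simp: K_def indicator_def\<close>)
        also have "\<dots> = (LINT x|lebesgue. indicat_real {T - t..T - u} (T + (-1) * x) *\<^sub>R m x)"
          unfolding m_def by (subst lebesgue_integral_real_affine[of "-1" _ T]) auto
        also have "\<dots> = (LINT x|lebesgue. indicat_real {u..t} x *\<^sub>R m x)"
          by (intro Bochner_Integration.integral_cong) (auto simp: indicator_def)
        also have "\<dots> = (LINT \<xi>|lebesgue_on {u..t}. m \<xi>)"
          by (subst integral_restrict_space) auto
        finally show ?thesis by simp
      qed
    qed
  qed
qed

text \<open>The primitive of \<open>k\<close> is uniformly continuous on \<open>[0, T]\<close>.\<close>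

lemma nonneg_Ld_integral_small:
  assumes d: "1 \<le> d" and k: "k \<in> nonneg_Ld d T" and "0 < \<epsilon>"
  obtains \<delta> where "0 < \<delta>"
    "\<And>u t. 0 \<le> u \<Longrightarrow> u \<le> t \<Longrightarrow> t \<le> T \<Longrightarrow> t - u < \<delta> \<Longrightarrow> (LINT \<xi>|lebesgue_on {u..t}. k \<xi>) < \<epsilon>"
proof -
  let ?I = "\<lambda>t. integral {0..t} k"
  have k_on: "k integrable_on {0..T}"
    by (intro integrable_on_lebesgue_on nonneg_Ld_integrable[OF d k]) auto
  then have "uniformly_continuous_on {0..T} ?I"
    by (intro compact_uniformly_continuous indefinite_integral_continuous_1) auto
  then obtain \<delta> where "0 < \<delta>" and
    \<delta>: "\<And>x y. x \<in> {0..T} \<Longrightarrow> y \<in> {0..T} \<Longrightarrow> dist y x < \<delta> \<Longrightarrow> dist (?I y) (?I x) < \<epsilon>"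
    unfolding uniformly_continuous_on_def using \<open>0 < \<epsilon>\<close> by metis
  show thesis
  proof (rule that[OF \<open>0 < \<delta>\<close>])
    fix u t :: real assume ut: "0 \<le> u" "u \<le> t" "t \<le> T" "t - u < \<delta>"
    have "(LINT \<xi>|lebesgue_on {u..t}. k \<xi>) = integral {u..t} k"
      using ut by (intro lebesgue_integral_eq_integral nonneg_Ld_integrable_subinterval[OF d k]) auto
    also have "\<dots> = ?I t - ?I u"
      using Henstock_Kurzweil_Integration.integral_combine[of 0 u t k] ut integrable_on_subinterval[OF k_on, of 0 t] by auto
    also have "\<dots> < \<epsilon>" using \<delta>[of u t] ut by (simp add: dist_real_def)
    finally show "(LINT \<xi>|lebesgue_on {u..t}. k \<xi>) < \<epsilon>" .
  qed
qed

section \<open>The Schwarz-Pick inequality\<close>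

text \<open>The quotient \<open>|z - w| / |1 - cnj w * z|\<close> is the pseudo-hyperbolic distance of \<open>z\<close> and \<open>w\<close>; the
  identity measures how far it is from \<open>1\<close>.\<close>

lemma cmod_one_minus_cnj_identity:
  "(cmod (1 - cnj w * z))\<^sup>2 - (cmod (z - w))\<^sup>2 = (1 - (cmod z)\<^sup>2) * (1 - (cmod w)\<^sup>2)"
  unfolding cmod_power2 by (simp add: power2_eq_square algebra_simps)

lemma one_minus_cnj_mult_nonzero:
  assumes "cmod w < 1" "cmod z < 1"
  shows "1 - cnj w * z \<noteq> 0"
proof -
  have "cmod (cnj w * z) < 1"
    using norm_mult_less[of "cnj w" 1 z 1] assms by simp
  then show ?thesis by auto
qed

lemma cmod_one_minus_cnj_mult_ge:
  assumes "cmod z < 1"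
  shows "1 - cmod w \<le> cmod (1 - cnj w * z)"
proof -
  have "1 - cmod w \<le> 1 - cmod w * cmod z" using assms by (simp add: mult_left_le)
  also have "\<dots> \<le> cmod (1 - cnj w * z)"
    by (metis complex_mod_cnj norm_mult norm_one norm_triangle_ineq2)
  finally show ?thesis .
qed

lemma cmod_one_minus_cnj_mult_le:
  assumes "cmod w \<le> 1" "cmod z \<le> 1"
  shows "cmod (1 - cnj w * z) \<le> 2"
proof -
  have "cmod (1 - cnj w * z) \<le> 1 + cmod w * cmod z"
    by (metis complex_mod_cnj norm_mult norm_one norm_triangle_ineq4)
  also have "\<dots> \<le> 1 + 1 * 1" using assms by (intro add_left_mono mult_mono) auto
  finally show ?thesis by simp
qed

definition disc_self_map :: "(complex \<Rightarrow> complex) \<Rightarrow> bool" where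
  "disc_self_map f \<longleftrightarrow> f holomorphic_on unit_disc \<and> f ` unit_disc \<subseteq> unit_disc"

lemma disc_self_map_cmod:
  "disc_self_map f \<Longrightarrow> cmod z < 1 \<Longrightarrow> cmod (f z) < 1"
  by (auto simp: disc_self_map_def image_subset_iff)

lemma disc_self_map_compose:
  assumes "disc_self_map f" "disc_self_map g"
  shows "disc_self_map (\<lambda>z. f (g z))"
  using assms holomorphic_on_compose_gen[of g unit_disc f unit_disc]
  by (auto simp: disc_self_map_def o_def)

lemma disc_self_map_Moebius:
  "cmod a < 1 \<Longrightarrow> disc_self_map (Moebius_function 0 a)"
  using Moebius_function_holomorphic[of a 0] Moebius_function_norm_lt_1[of a _ 0]
  by (auto simp: disc_self_map_def)

lemma Moebius_inverse:
  assumes "cmod a < 1" "cmod z < 1"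
  shows "Moebius_function 0 (- a) (Moebius_function 0 a z) = z"
  using assms by (intro Moebius_function_compose) auto

lemma cmod_Moebius:
  "cmod (Moebius_function 0 w z) = cmod (z - w) / cmod (1 - cnj w * z)"
  by (simp add: Moebius_function_simple norm_divide)

text \<open>The Schwarz lemma, applied after moving \<open>w\<close> and \<open>f w\<close> to the origin by Moebius transformations:
  \<open>f\<close> does not increase the pseudo-hyperbolic distance.\<close>

lemma Schwarz_Pick:
  assumes f: "disc_self_map f" and z: "cmod z < 1" and w: "cmod w < 1"
  shows "cmod (f z - f w) * cmod (1 - cnj w * z) \<le> cmod (z - w) * cmod (1 - cnj (f w) * f z)"
proof -
  define g where "g = (\<lambda>x. Moebius_function 0 (f w) (f (Moebius_function 0 (- w) x)))"
  have fz: "cmod (f z) < 1" "cmod (f w) < 1" using f z w disc_self_map_cmod by auto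
  have g: "disc_self_map g"
    unfolding g_def using w fz
    by (intro disc_self_map_compose[OF disc_self_map_Moebius disc_self_map_compose[OF f disc_self_map_Moebius]]) auto
  let ?x = "Moebius_function 0 w z"
  have x: "cmod ?x < 1" using w z by (rule Moebius_function_norm_lt_1)
  have "cmod (g ?x) \<le> cmod ?x"
    using g x disc_self_map_cmod[OF g]
    by (intro Schwarz_Lemma(1)) (auto simp: disc_self_map_def g_def Moebius_function_of_zero Moebius_function_eq_zero)
  moreover have "g ?x = Moebius_function 0 (f w) (f z)"
    using Moebius_inverse[OF w z] by (simp add: g_def)
  ultimately have "cmod (f z - f w) / cmod (1 - cnj (f w) * f z) \<le> cmod (z - w) / cmod (1 - cnj w * z)"
    by (simp add: cmod_Moebius)
  moreover have "0 < cmod (1 - cnj w * z)" "0 < cmod (1 - cnj (f w) * f z)"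
    using one_minus_cnj_mult_nonzero z w fz by auto
  ultimately show ?thesis by (simp add: field_simps)
qed

text \<open>In the Schwarz-Pick inequality \<open>|1 - cnj w * z| \<ge> 1 - |w|\<close> holds for every \<open>z\<close> in the disc, so that only one
  of the two points has to stay away from the unit circle.\<close>

corollary disc_self_map_Lipschitz:
  assumes "disc_self_map f" "cmod z < 1" "cmod w < 1"
  shows "cmod (f z - f w) \<le> 2 / (1 - cmod w) * cmod (z - w)"
proof -
  have "cmod (f z - f w) * (1 - cmod w) \<le> cmod (f z - f w) * cmod (1 - cnj w * z)"
    using assms by (intro mult_left_mono cmod_one_minus_cnj_mult_ge) auto
  also have "\<dots> \<le> cmod (z - w) * cmod (1 - cnj (f w) * f z)"
    by (rule Schwarz_Pick[OF assms])
  also have "\<dots> \<le> cmod (z - w) * 2"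
    using disc_self_map_cmod[OF assms(1)] assms
    by (intro mult_left_mono cmod_one_minus_cnj_mult_le) (auto intro: less_imp_le)
  finally show ?thesis using assms by (simp add: field_simps)
qed

text \<open>A self-map that does not move the origin far cannot push a point much closer to the unit circle. The
  distance to the circle is measured by \<open>1 - |z|\<^sup>2\<close>, for which the bound is multiplicative, so that
  it can be iterated along a composition. It results from the Schwarz-Pick inequality at \<open>z\<close> and \<open>0\<close>, read
  through the identity for the pseudo-hyperbolic distance.\<close>

corollary disc_self_map_boundary_distance:
  assumes "disc_self_map f" "cmod (f 0) \<le> 1 / 2" "cmod z < 1"
  shows "(1 - (cmod z)\<^sup>2) / 4 \<le> 1 - (cmod (f z))\<^sup>2"
proof -
  let ?A = "cmod (1 - cnj (f 0) * f z)"
  have fz: "cmod (f z) < 1" using assms disc_self_map_cmod by auto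
  have A: "1 / 2 \<le> ?A" using cmod_one_minus_cnj_mult_ge[OF fz, of "f 0"] assms by simp
  have "cmod (f z - f 0) \<le> cmod z * ?A"
    using Schwarz_Pick[OF assms(1,3), of 0] by simp
  then have "(cmod (f z - f 0))\<^sup>2 \<le> (cmod z)\<^sup>2 * ?A\<^sup>2"
    by (metis norm_ge_zero power_mono power_mult_distrib)
  then have "(1 - (cmod z)\<^sup>2) * ?A\<^sup>2 \<le> (1 - (cmod (f z))\<^sup>2) * (1 - (cmod (f 0))\<^sup>2)"
    using cmod_one_minus_cnj_identity[of "f 0" "f z"] by (simp add: algebra_simps)
  also have "\<dots> \<le> (1 - (cmod (f z))\<^sup>2) * 1"
    using fz by (intro mult_left_mono) (auto simp: power_le_one)
  finally have 1: "(1 - (cmod z)\<^sup>2) * ?A\<^sup>2 \<le> 1 - (cmod (f z))\<^sup>2" by simp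
  have "(1/2)\<^sup>2 \<le> ?A\<^sup>2" using A by (intro power_mono) auto
  then have "(1 - (cmod z)\<^sup>2) * (1/4) \<le> (1 - (cmod z)\<^sup>2) * ?A\<^sup>2"
    using assms by (intro mult_left_mono) (auto simp: power_le_one power_divide)
  with 1 show ?thesis by simp
qed

section \<open>Self-maps of the disc that almost fix two points\<close>

text \<open>The function \<open>1 - h\<close> has non-negative real part, so this is a form of Harnack's inequality. It follows from
  the Schwarz-Pick inequality: with \<open>x = 1 - h w\<close> and \<open>y = 1 - h v\<close>, the quantity
  \<open>1 - cnj (h v) * h w\<close> equals \<open>x + cnj y * h w\<close>, hence has norm at most \<open>|x| + |y|\<close>, while
  \<open>|h w - h v| \<ge> |x| - |y|\<close>. Thus \<open>|x| - |y| \<le> \<rho> * (|x| + |y|)\<close>, where \<open>\<rho> < 1\<close> is the pseudo-hyperbolic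
  distance of \<open>v\<close> and \<open>w\<close>.\<close>

lemma Harnack_at_boundary_value_one:
  assumes h: "h holomorphic_on unit_disc" "\<And>z. cmod z < 1 \<Longrightarrow> cmod (h z) \<le> 1"
    and v: "cmod v < 1" and w: "cmod w < 1"
  shows "(1 - (cmod v)\<^sup>2) * (1 - (cmod w)\<^sup>2) * cmod (1 - h w) \<le> 16 * cmod (1 - h v)"
proof -
  define A B where "A = cmod (1 - cnj v * w)" and "B = cmod (w - v)"
  \<comment> \<open>As \<open>h\<close> may take values on the unit circle, Schwarz-Pick is applied to \<open>c * h\<close> with \<open>c < 1\<close>.\<close>
  have SP: "cmod (h w - h v) * A \<le> B * cmod (1 - cnj (h v) * h w)"
  proof (rule tendsto_le[OF trivial_limit_at_left_real])
    let ?l = "\<lambda>c::real. cmod (of_real c * h w - of_real c * h v) * A"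
    let ?r = "\<lambda>c::real. B * cmod (1 - cnj (of_real c * h v) * (of_real c * h w))"
    have "(?l \<longlongrightarrow> ?l 1) (at_left 1)" "(?r \<longlongrightarrow> ?r 1) (at_left 1)"
      by (intro tendsto_intros)+
    then show "(?l \<longlongrightarrow> cmod (h w - h v) * A) (at_left 1)"
      "(?r \<longlongrightarrow> B * cmod (1 - cnj (h v) * h w)) (at_left 1)" by simp_all
    have "?l c \<le> ?r c" if c: "0 < c" "c < 1" for c
    proof -
      have "disc_self_map (\<lambda>z. of_real c * h z)"
        unfolding disc_self_map_def
      proof (intro conjI image_subsetI holomorphic_intros h)
        fix z :: complex assume "z \<in> unit_disc"
        then have "c * cmod (h z) \<le> c * 1" using h c by (intro mult_left_mono) auto
        then have "c * cmod (h z) < 1" using c by linarith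
        then show "complex_of_real c * h z \<in> unit_disc" using c by (simp add: norm_mult)
      qed
      from Schwarz_Pick[OF this w v] show ?thesis by (simp add: A_def B_def)
    qed
    then show "\<forall>\<^sub>F c in at_left 1. ?l c \<le> ?r c"
      unfolding eventually_at_left_field by (intro exI[of _ 0]) auto
  qed
  define x y where "x = 1 - h w" and "y = 1 - h v"
  have "1 - cnj (h v) * h w = x + cnj y * h w" by (simp add: x_def y_def algebra_simps)
  then have "cmod (1 - cnj (h v) * h w) \<le> cmod x + cmod y * cmod (h w)"
    by (metis complex_mod_cnj norm_mult norm_triangle_ineq)
  also have "\<dots> \<le> cmod x + cmod y" using h(2)[OF w] by (simp add: mult_left_le)
  finally have "B * cmod (1 - cnj (h v) * h w) \<le> B * (cmod x + cmod y)"
    by (intro mult_left_mono) (auto simp: B_def)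
  moreover have "cmod x - cmod y \<le> cmod (h w - h v)"
    using norm_triangle_ineq2[of x y] by (simp add: x_def y_def norm_minus_commute)
  then have "(cmod x - cmod y) * A \<le> cmod (h w - h v) * A"
    by (intro mult_right_mono) (auto simp: A_def)
  ultimately have 1: "(A - B) * cmod x \<le> (A + B) * cmod y"
    using SP by (simp add: algebra_simps)
  have A: "A \<le> 2" using cmod_one_minus_cnj_mult_le[of v w] v w by (simp add: A_def)
  have B: "B \<le> 2" using norm_triangle_ineq4[of w v] v w by (simp add: B_def)
  have AB0: "0 \<le> A" "0 \<le> B" by (auto simp: A_def B_def)
  \<comment> \<open>Multiplying by \<open>A + B \<le> 4\<close> turns \<open>A - B\<close> into the product on the left of the claim.\<close>
  have "A\<^sup>2 - B\<^sup>2 = (1 - (cmod v)\<^sup>2) * (1 - (cmod w)\<^sup>2)"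
    using cmod_one_minus_cnj_identity[of v w] by (simp add: A_def B_def mult.commute)
  then have "(1 - (cmod v)\<^sup>2) * (1 - (cmod w)\<^sup>2) * cmod x = (A + B) * ((A - B) * cmod x)"
    by (metis mult.assoc mult.commute power2_eq_square square_diff_square_factored)
  also have "\<dots> \<le> (A + B) * ((A + B) * cmod y)"
    using 1 AB0 by (intro mult_left_mono) auto
  also have "\<dots> \<le> 4 * (4 * cmod y)"
    using A B AB0 by (intro mult_mono) auto
  finally show ?thesis by (simp add: x_def y_def)
qed

text \<open>Lipschitz in the point and in the parameter together, uniformly while the parameters stay in a
  compact part of the disc. It allows one to compare \<open>f\<close>, conjugated by two different Moebius
  transformations, with the identity.\<close>

lemma Moebius_joint_Lipschitz:
  assumes "cmod a \<le> \<rho>" "cmod b \<le> \<rho>" "\<rho> < 1" "cmod z < 1" "cmod w < 1"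
  shows "cmod (Moebius_function 0 a z - Moebius_function 0 b w)
    \<le> 4 / (1 - \<rho>)\<^sup>2 * (cmod (z - w) + cmod (a - b))"
proof -
  have \<rho>: "0 \<le> \<rho>" using assms(1) norm_ge_zero order_trans by blast
  have ne: "1 - cnj a * z \<noteq> 0" "1 - cnj a * w \<noteq> 0" "1 - cnj b * w \<noteq> 0"
    by (intro one_minus_cnj_mult_nonzero; use assms in linarith)+
  have ge: "1 - \<rho> \<le> cmod (1 - cnj a * z)" "1 - \<rho> \<le> cmod (1 - cnj a * w)" "1 - \<rho> \<le> cmod (1 - cnj b * w)"
    using assms cmod_one_minus_cnj_mult_ge[of z a] cmod_one_minus_cnj_mult_ge[of w a] cmod_one_minus_cnj_mult_ge[of w b]
    by linarith+
  have "Moebius_function 0 a z - Moebius_function 0 a w =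
      (z - w) * (1 - a * cnj a) / ((1 - cnj a * z) * (1 - cnj a * w))"
    using ne by (simp add: Moebius_function_simple divide_simps) (simp add: algebra_simps)
  then have "cmod (Moebius_function 0 a z - Moebius_function 0 a w) =
      cmod (z - w) * cmod (1 - a * cnj a) / (cmod (1 - cnj a * z) * cmod (1 - cnj a * w))"
    by (simp add: norm_mult norm_divide)
  also have "\<dots> \<le> cmod (z - w) * 2 / ((1 - \<rho>) * (1 - \<rho>))"
    using ge assms cmod_one_minus_cnj_mult_le[of a a] 
    by (intro frac_le mult_mono mult_nonneg_nonneg mult_pos_pos) (auto simp: mult.commute)
  finally have 1: "cmod (Moebius_function 0 a z - Moebius_function 0 a w) \<le> 2 * cmod (z - w) / (1 - \<rho>)\<^sup>2"
    by (simp add: power2_eq_square mult.commute)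
  \<comment> \<open>The numerator of the difference over the common denominator, arranged so that every term contains
    \<open>a - b\<close> or its conjugate.\<close>
  define N where "N = (b - a) + (cnj a - cnj b) * w * w + w * ((a - b) * cnj b - (cnj a - cnj b) * b)"
  have "Moebius_function 0 a w - Moebius_function 0 b w = N / ((1 - cnj a * w) * (1 - cnj b * w))"
    using ne by (simp add: Moebius_function_simple divide_simps) (simp add: N_def algebra_simps)
  then have "cmod (Moebius_function 0 a w - Moebius_function 0 b w) =
      cmod N / (cmod (1 - cnj a * w) * cmod (1 - cnj b * w))"
    by (simp add: norm_mult norm_divide)
  also have "\<dots> \<le> 4 * cmod (a - b) / ((1 - \<rho>) * (1 - \<rho>))"
  proof (intro frac_le mult_mono mult_pos_pos)
    let ?e = "cmod (a - b)"
    have e: "cmod (cnj a - cnj b) = ?e" by (metis complex_cnj_diff complex_mod_cnj)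
    have "cmod N \<le> cmod (b - a) + cmod ((cnj a - cnj b) * w * w) + cmod (w * ((a - b) * cnj b - (cnj a - cnj b) * b))"
      unfolding N_def by (intro order_trans[OF norm_triangle_ineq] add_right_mono norm_triangle_ineq)
    also have "cmod ((cnj a - cnj b) * w * w) \<le> ?e * 1 * 1"
      unfolding norm_mult e using assms by (intro mult_mono) auto
    also have "cmod (w * ((a - b) * cnj b - (cnj a - cnj b) * b)) \<le> 1 * (?e * 1 + ?e * 1)"
      unfolding norm_mult
    proof (intro mult_mono order_trans[OF norm_triangle_ineq4] add_mono)
      show "cmod ((a - b) * cnj b) \<le> ?e * 1" "cmod ((cnj a - cnj b) * b) \<le> ?e * 1"
        unfolding norm_mult e using assms by (auto intro!: mult_left_le)
    qed (use assms in auto)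
    finally show "cmod N \<le> 4 * ?e" by (simp add: norm_minus_commute)
  qed (use ge assms in auto)
  finally have 2: "cmod (Moebius_function 0 a w - Moebius_function 0 b w) \<le> 4 * cmod (a - b) / (1 - \<rho>)\<^sup>2"
    by (simp add: power2_eq_square)
  have "cmod (Moebius_function 0 a z - Moebius_function 0 b w)
     \<le> 2 * cmod (z - w) / (1 - \<rho>)\<^sup>2 + 4 * cmod (a - b) / (1 - \<rho>)\<^sup>2"
    using norm_triangle_ineq[of "Moebius_function 0 a z - Moebius_function 0 a w" "Moebius_function 0 a w - Moebius_function 0 b w"] 1 2
    by simp
  also have "\<dots> \<le> 4 * cmod (z - w) / (1 - \<rho>)\<^sup>2 + 4 * cmod (a - b) / (1 - \<rho>)\<^sup>2"
    by (intro add_right_mono divide_right_mono) auto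
  finally show ?thesis by (simp add: algebra_simps add_divide_distrib)
qed

lemma Schwarz_quotient:
  assumes g: "disc_self_map g" "g 0 = 0"
  obtains h where "h holomorphic_on unit_disc" "\<And>z. cmod z < 1 \<Longrightarrow> g z = z * h z"
    "\<And>z. cmod z < 1 \<Longrightarrow> cmod (h z) \<le> 1"
proof -
  have hol: "g holomorphic_on unit_disc" using g by (simp add: disc_self_map_def)
  obtain h where h: "h holomorphic_on unit_disc" "\<And>z. cmod z < 1 \<Longrightarrow> g z = z * h z" "deriv g 0 = h 0"
    using Schwarz3[OF hol g(2)] by metis
  have "cmod (h z) \<le> 1" if z: "cmod z < 1" for z
  proof (cases "z = 0")
    case True then show ?thesis
      using Schwarz_Lemma(2)[OF hol g(2) disc_self_map_cmod[OF g(1)], of 0] h by simp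
  next
    case False
    have "cmod z * cmod (h z) \<le> cmod z * 1"
      using Schwarz_Lemma(1)[OF hol g(2) disc_self_map_cmod[OF g(1)] z] h(2)[OF z] by (simp add: norm_mult)
    then show ?thesis using False by simp
  qed
  with h that show thesis by blast
qed

text \<open>If \<open>b\<close> and \<open>c\<close> were fixed by \<open>f\<close>, then \<open>f\<close> would be the identity; the lemma is the linear stability of
  this rigidity, with a constant that is the same for all self-maps. Move \<open>b\<close> and \<open>f b\<close> to the origin, so that
  \<open>f\<close> becomes \<open>g z = z * h z\<close>. That \<open>c\<close> is almost fixed means that \<open>1 - h\<close> is small at the image \<open>v\<close>
  of \<open>c\<close>. By the Harnack inequality \<open>1 - h\<close>, and with it \<open>g z - z\<close>, is small on compact sets, and
  so is \<open>f z - z\<close> because the two Moebius transformations are close to each other.\<close>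

lemma two_point_displacement_bound:
  assumes b: "cmod b < 1" and c: "cmod c < 1" and bc: "b \<noteq> c" and r: "0 \<le> r" "r < 1"
  obtains C where "0 \<le> C"
    "\<And>f z. disc_self_map f \<Longrightarrow> cmod z \<le> r \<Longrightarrow> cmod (f z - z) \<le> C * (cmod (f b - b) + cmod (f c - c))"
proof -
  \<comment> \<open>\<open>\<rho>\<close> bounds \<open>|f b|\<close> when \<open>f b\<close> is close to \<open>b\<close>; \<open>\<delta>\<close> bounds \<open>1 - |w|\<^sup>2\<close> from below for the images \<open>w\<close> of
    the points with \<open>|z| \<le> r\<close>; \<open>C1\<close> is the constant when \<open>f b\<close> is close to \<open>b\<close>, and \<open>C2\<close> when it is not.\<close>
  define \<rho> where "\<rho> = (1 + cmod b) / 2"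
  have \<rho>: "cmod b \<le> \<rho>" "0 < \<rho>" "\<rho> < 1" using b by (auto simp: \<rho>_def add_pos_nonneg)
  define L where "L = 4 / (1 - \<rho>)\<^sup>2"
  have L: "0 \<le> L" by (simp add: L_def)
  define v where "v = Moebius_function 0 b c"
  have v: "cmod v < 1" "v \<noteq> 0"
    using Moebius_function_norm_lt_1[OF b c, of 0] one_minus_cnj_mult_nonzero[OF b c] bc
    by (simp_all add: v_def Moebius_function_simple)
  define \<delta> where "\<delta> = (1 - (cmod b)\<^sup>2) * (1 - r\<^sup>2) / 4"
  have \<delta>: "0 < \<delta>" using b r by (auto simp: \<delta>_def abs_square_less_1)
  define M where "M = 16 / ((1 - (cmod v)\<^sup>2) * \<delta>)"
  have M: "0 \<le> M" using v \<delta> by (auto simp: M_def abs_square_le_1)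
  define C1 where "C1 = L * (M * (L / cmod v) + 1)"
  define C2 where "C2 = 4 / (1 - cmod b)"
  have C: "0 \<le> C1" "0 \<le> C2" using L M b by (auto simp: C1_def C2_def)
  show thesis
  proof (rule that[of "C1 + C2"])
    fix f z assume f: "disc_self_map f" and zr: "cmod z \<le> r"
    define a E where "a = f b" and "E = cmod (f b - b) + cmod (f c - c)"
    have E: "0 \<le> E" by (simp add: E_def)
    have z: "cmod z < 1" using zr r by simp
    have a: "cmod a < 1" and fz: "cmod (f z) < 1" and fc: "cmod (f c) < 1"
      using f b c z disc_self_map_cmod by (auto simp: a_def)
    have "cmod (f z - z) \<le> (C1 + C2) * E"
    proof (cases "cmod (a - b) \<le> (1 - cmod b) / 2")
      case False
      \<comment> \<open>A displacement never exceeds \<open>2\<close>, and here \<open>C2 * cmod (f b - b)\<close> is at least \<open>2\<close>.\<close>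
      then have "2 \<le> C2 * cmod (a - b)"
        using b by (auto simp: C2_def field_simps)
      also have "\<dots> \<le> (C1 + C2) * E"
        using C by (intro mult_mono) (auto simp: E_def a_def)
      finally show ?thesis using norm_triangle_ineq4[of "f z" z] fz z by simp
    next
      case True
      have "cmod a \<le> \<rho>"
        using norm_triangle_ineq2[of a b] True unfolding \<rho>_def by argo
      note lip = Moebius_joint_Lipschitz[OF _ _ \<rho>(3), folded L_def]
      define g where "g = (\<lambda>x. Moebius_function 0 a (f (Moebius_function 0 (- b) x)))"
      have g: "disc_self_map g"
        unfolding g_def using a b
        by (intro disc_self_map_compose[OF disc_self_map_Moebius disc_self_map_compose[OF f disc_self_map_Moebius]]) auto
      have g_eq: "g (Moebius_function 0 b x) = Moebius_function 0 a (f x)" if "cmod x < 1" for x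
        using Moebius_inverse[OF b that] by (simp add: g_def)
      have "g 0 = 0"
        by (simp add: g_def Moebius_function_of_zero Moebius_function_eq_zero a_def)
      then obtain h where h: "h holomorphic_on unit_disc" "\<And>x. cmod x < 1 \<Longrightarrow> g x = x * h x"
          "\<And>x. cmod x < 1 \<Longrightarrow> cmod (h x) \<le> 1"
        using Schwarz_quotient[OF g] by metis
      define w where "w = Moebius_function 0 b z"
      have w: "cmod w < 1" using Moebius_function_norm_lt_1[OF b z] by (simp add: w_def)
      have \<delta>w: "\<delta> \<le> 1 - (cmod w)\<^sup>2"
      proof -
        let ?A = "cmod (1 - cnj b * z)"
        have A: "0 < ?A" "?A \<le> 2"
          using one_minus_cnj_mult_nonzero[OF b z] cmod_one_minus_cnj_mult_le[of b z] b z by auto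
        have "1 - (cmod w)\<^sup>2 = (1 - (cmod z)\<^sup>2) * (1 - (cmod b)\<^sup>2) / ?A\<^sup>2"
          using A cmod_one_minus_cnj_identity[of b z] unfolding w_def cmod_Moebius
          by (simp add: power_divide field_simps)
        also have "\<dots> \<ge> (1 - r\<^sup>2) * (1 - (cmod b)\<^sup>2) / 2\<^sup>2"
          using A b z zr r
          by (intro frac_le mult_mono power_mono diff_left_mono) (auto simp: abs_square_le_1 power_le_one mult_nonneg_nonneg)
        finally show ?thesis by (simp add: \<delta>_def mult.commute)
      qed
      have "cmod v * cmod (1 - h v) = cmod (g v - v)"
        using h(2)[OF v(1)] by (simp add: norm_mult[symmetric] algebra_simps norm_minus_commute)
      also have "\<dots> = cmod (Moebius_function 0 a (f c) - Moebius_function 0 b c)"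
        using g_eq[OF c] by (simp add: v_def)
      also have "\<dots> \<le> L * E"
        using lip[of a b "f c" c] \<open>cmod a \<le> \<rho>\<close> \<rho> fc c by (simp add: E_def a_def add.commute)
      finally have hv: "cmod (1 - h v) \<le> L / cmod v * E"
        using v by (simp add: field_simps)
      have "(1 - (cmod v)\<^sup>2) * \<delta> * cmod (1 - h w) \<le> (1 - (cmod v)\<^sup>2) * (1 - (cmod w)\<^sup>2) * cmod (1 - h w)"
        using \<delta>w v by (intro mult_right_mono mult_left_mono) (auto simp: abs_square_le_1)
      also have "\<dots> \<le> 16 * cmod (1 - h v)"
        by (rule Harnack_at_boundary_value_one[OF h(1,3) v(1) w])
      finally have "cmod (1 - h w) \<le> M * cmod (1 - h v)"
        using v \<delta> by (simp add: M_def field_simps abs_square_less_1)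
      also have "\<dots> \<le> M * (L / cmod v * E)"
        using hv M by (intro mult_left_mono)
      finally have hw: "cmod (1 - h w) \<le> M * (L / cmod v) * E" by simp
      have gw: "cmod (g w - w) \<le> cmod (1 - h w)"
        using h(2)[OF w] w mult_right_le_one_le[of "cmod (1 - h w)" "cmod w"]
        by (simp add: norm_mult[symmetric] algebra_simps norm_minus_commute)
      have "f z = Moebius_function 0 (- a) (g w)"
        using Moebius_inverse[OF a fz] g_eq[OF z] by (simp add: w_def)
      moreover have "z = Moebius_function 0 (- b) w"
        using Moebius_inverse[OF b z] by (simp add: w_def)
      ultimately have "cmod (f z - z) = cmod (Moebius_function 0 (- a) (g w) - Moebius_function 0 (- b) w)"
        by metis
      also have "\<dots> \<le> L * (cmod (g w - w) + cmod (a - b))"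
        using lip[of "- a" "- b" "g w" w] \<open>cmod a \<le> \<rho>\<close> \<rho> w disc_self_map_cmod[OF g w]
        by (simp add: norm_minus_commute)
      also have "\<dots> \<le> L * (M * (L / cmod v) * E + E)"
        using gw hw L by (intro mult_left_mono add_mono) (auto simp: E_def a_def)
      also have "\<dots> = C1 * E" by (simp add: C1_def algebra_simps)
      also have "\<dots> \<le> (C1 + C2) * E" using C E by (intro mult_right_mono) auto
      finally show ?thesis .
    qed
    then show "cmod (f z - z) \<le> (C1 + C2) * (cmod (f b - b) + cmod (f c - c))"
      by (simp add: E_def)
  qed (use C in auto)
qed

text \<open>The Lipschitz constant of \<open>f z - z\<close> on the smaller disc is below \<open>1\<close>. To see this, rescale
  \<open>f z - z\<close> to a self-map of the unit disc.\<close>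

lemma near_identity_injective:
  assumes f: "f holomorphic_on ball 0 \<rho>" and r: "0 \<le> r" "r < \<rho>" and "0 < \<epsilon>"
    and small: "2 * \<epsilon> < \<rho> - r"
    and near: "\<And>z. cmod z < \<rho> \<Longrightarrow> cmod (f z - z) < \<epsilon>"
  shows "inj_on f (cball 0 r)"
proof (rule inj_onI, rule ccontr)
  fix z w assume z: "z \<in> cball 0 r" and w: "w \<in> cball 0 r" and eq: "f z = f w" and ne: "z \<noteq> w"
  have \<rho>: "0 < \<rho>" using r by simp
  let ?e = "\<lambda>x. (f (of_real \<rho> * x) - of_real \<rho> * x) / of_real \<epsilon>"
  have ball: "of_real \<rho> * x \<in> ball 0 \<rho>" if "x \<in> unit_disc" for x :: complex
    using that \<rho> by (simp add: norm_mult)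
  have e: "disc_self_map ?e"
    unfolding disc_self_map_def
  proof (intro conjI holomorphic_intros image_subsetI)
    show "(\<lambda>x. f (of_real \<rho> * x)) holomorphic_on unit_disc"
      using holomorphic_on_compose_gen[OF _ f, of "\<lambda>x. of_real \<rho> * x" unit_disc] ball
      by (simp add: o_def holomorphic_intros image_subset_iff)
  next
    fix x :: complex assume "x \<in> unit_disc"
    then show "?e x \<in> unit_disc"
      using near[of "of_real \<rho> * x"] ball[of x] \<open>0 < \<epsilon>\<close> by (simp add: norm_divide)
  qed (use \<open>0 < \<epsilon>\<close> in auto)
  have norms: "cmod (z / of_real \<rho>) < 1" "cmod (w / of_real \<rho>) < 1"
    using z w r \<rho> by (auto simp: norm_divide)
  have "cmod (?e (z / of_real \<rho>) - ?e (w / of_real \<rho>)) =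
      cmod (z - w) / \<epsilon>"
    using \<rho> \<open>0 < \<epsilon>\<close> eq by (simp add: norm_divide diff_divide_distrib[symmetric] norm_minus_commute)
  moreover have "cmod (z / of_real \<rho> - w / of_real \<rho>) = cmod (z - w) / \<rho>"
    using \<rho> by (simp add: norm_divide diff_divide_distrib[symmetric])
  ultimately have "cmod (z - w) / \<epsilon> \<le> 2 / (1 - cmod w / \<rho>) * (cmod (z - w) / \<rho>)"
    using disc_self_map_Lipschitz[OF e norms] \<rho> by (simp add: norm_divide)
  also have "\<dots> = 2 / (\<rho> - cmod w) * cmod (z - w)"
    using \<rho> w r by (simp add: field_simps)
  also have "\<dots> \<le> 2 / (\<rho> - r) * cmod (z - w)"
    using w r by (intro mult_right_mono divide_left_mono) auto
  finally have "cmod (z - w) * (1 / \<epsilon>) \<le> cmod (z - w) * (2 / (\<rho> - r))" by (simp add: mult.commute)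
  then have "1 / \<epsilon> \<le> 2 / (\<rho> - r)" by (rule mult_left_le_imp_le) (use ne in simp)
  then show False using \<open>0 < \<epsilon>\<close> small r by (simp add: field_simps)
qed

section \<open>Control of displacements from two points\<close>

text \<open>The common reformulation of all the conditions. Only comparisons with the identity occur in it, so it is
  equally accessible from bounds on the increments in either parameter.\<close>

definition displacement_controlled :: "ereal \<Rightarrow> real \<Rightarrow> (real \<Rightarrow> real \<Rightarrow> complex \<Rightarrow> complex) \<Rightarrow> bool" where
  "displacement_controlled d T \<phi> \<longleftrightarrow> (\<forall>r. 0 \<le> r \<longrightarrow> r < 1 \<longrightarrow> (\<exists>k\<in>nonneg_Ld d T.
     \<forall>z\<in>cball 0 r. \<forall>s t. 0 \<le> s \<longrightarrow> s \<le> t \<longrightarrow> t \<le> T \<longrightarrow>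
       cmod (\<phi> s t z - z) \<le> (LINT \<xi>|lebesgue_on {s..t}. k \<xi>)))"

lemma displacement_controlledE:
  assumes "displacement_controlled d T \<phi>" "0 \<le> r" "r < 1"
  obtains k where "k \<in> nonneg_Ld d T"
    "\<And>z s t. cmod z \<le> r \<Longrightarrow> 0 \<le> s \<Longrightarrow> s \<le> t \<Longrightarrow> t \<le> T \<Longrightarrow>
       cmod (\<phi> s t z - z) \<le> (LINT \<xi>|lebesgue_on {s..t}. k \<xi>)"
  using assms unfolding displacement_controlled_def by (metis mem_cball_0)

lemma disc_self_map_family_iff:
  "disc_self_map_family \<phi> \<longleftrightarrow> (\<forall>s t. 0 \<le> s \<longrightarrow> s \<le> t \<longrightarrow> disc_self_map (\<phi> s t))"
  by (simp add: disc_self_map_family_def disc_self_map_def)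

lemma displacement_controlled_of_two_points:
  assumes d: "1 \<le> d" and \<phi>: "disc_self_map_family \<phi>"
    and disc: "\<zeta>\<^sub>1 \<in> unit_disc" "\<zeta>\<^sub>2 \<in> unit_disc" and ne: "\<zeta>\<^sub>1 \<noteq> \<zeta>\<^sub>2"
    and control: "\<And>\<zeta>. \<zeta> \<in> {\<zeta>\<^sub>1, \<zeta>\<^sub>2} \<Longrightarrow> \<exists>k\<in>nonneg_Ld d T. \<forall>s t. 0 \<le> s \<longrightarrow> s \<le> t \<longrightarrow> t \<le> T \<longrightarrow>
       cmod (\<phi> s t \<zeta> - \<zeta>) \<le> (LINT \<xi>|lebesgue_on {s..t}. k \<xi>)"
  shows "displacement_controlled d T \<phi>"
proof -
  obtain k\<^sub>1 k\<^sub>2 where k: "k\<^sub>1 \<in> nonneg_Ld d T" "k\<^sub>2 \<in> nonneg_Ld d T"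
    and k\<^sub>1: "\<And>s t. 0 \<le> s \<Longrightarrow> s \<le> t \<Longrightarrow> t \<le> T \<Longrightarrow> cmod (\<phi> s t \<zeta>\<^sub>1 - \<zeta>\<^sub>1) \<le> (LINT \<xi>|lebesgue_on {s..t}. k\<^sub>1 \<xi>)"
    and k\<^sub>2: "\<And>s t. 0 \<le> s \<Longrightarrow> s \<le> t \<Longrightarrow> t \<le> T \<Longrightarrow> cmod (\<phi> s t \<zeta>\<^sub>2 - \<zeta>\<^sub>2) \<le> (LINT \<xi>|lebesgue_on {s..t}. k\<^sub>2 \<xi>)"
    using control[of \<zeta>\<^sub>1] control[of \<zeta>\<^sub>2] by auto
  define k where "k = (\<lambda>x. max (k\<^sub>1 x) (k\<^sub>2 x))"
  have kL: "k \<in> nonneg_Ld d T" unfolding k_def by (rule nonneg_Ld_max[OF d k])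
  have two: "cmod (\<phi> s t \<zeta>\<^sub>1 - \<zeta>\<^sub>1) + cmod (\<phi> s t \<zeta>\<^sub>2 - \<zeta>\<^sub>2) \<le> 2 * (LINT \<xi>|lebesgue_on {s..t}. k \<xi>)"
    if "0 \<le> s" "s \<le> t" "t \<le> T" for s t
    using k\<^sub>1[OF that] k\<^sub>2[OF that] nonneg_Ld_integral_mono[OF d k(1) kL, of s t]
      nonneg_Ld_integral_mono[OF d k(2) kL, of s t] that by (simp add: k_def)
  show ?thesis
    unfolding displacement_controlled_def
  proof (intro allI impI)
    fix r :: real assume r: "0 \<le> r" "r < 1"
    obtain C where C: "0 \<le> C" "\<And>f z. disc_self_map f \<Longrightarrow> cmod z \<le> r \<Longrightarrow>
        cmod (f z - z) \<le> C * (cmod (f \<zeta>\<^sub>1 - \<zeta>\<^sub>1) + cmod (f \<zeta>\<^sub>2 - \<zeta>\<^sub>2))"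
      using two_point_displacement_bound[of \<zeta>\<^sub>1 \<zeta>\<^sub>2 r] disc ne r by (metis mem_ball_0)
    show "\<exists>k\<in>nonneg_Ld d T. \<forall>z\<in>cball 0 r. \<forall>s t. 0 \<le> s \<longrightarrow> s \<le> t \<longrightarrow> t \<le> T \<longrightarrow>
        cmod (\<phi> s t z - z) \<le> (LINT \<xi>|lebesgue_on {s..t}. k \<xi>)"
    proof (intro bexI[of _ "\<lambda>x. (C * 2) * k x"] ballI allI impI nonneg_Ld_scale kL)
      fix z :: complex and s t assume z: "z \<in> cball 0 r" and st: "0 \<le> s" "s \<le> t" "t \<le> T"
      have "cmod (\<phi> s t z - z) \<le> C * (cmod (\<phi> s t \<zeta>\<^sub>1 - \<zeta>\<^sub>1) + cmod (\<phi> s t \<zeta>\<^sub>2 - \<zeta>\<^sub>2))"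
        using C(2) \<phi> z st by (simp add: disc_self_map_family_iff)
      also have "\<dots> \<le> C * (2 * (LINT \<xi>|lebesgue_on {s..t}. k \<xi>))"
        using C(1) two[OF st] by (rule mult_left_mono[rotated])
      finally show "cmod (\<phi> s t z - z) \<le> (LINT \<xi>|lebesgue_on {s..t}. (C * 2) * k \<xi>)"
        by (simp add: mult.assoc)
    qed (use C in auto)
  qed
qed

text \<open>Convenient when a bound is known at every point, with a control function that depends on the
  point: any two points will do.\<close>

lemma displacement_controlled_of_pointwise:
  assumes "1 \<le> d" "disc_self_map_family \<phi>"
    and "\<And>\<zeta>. \<zeta> \<in> unit_disc \<Longrightarrow> \<exists>k\<in>nonneg_Ld d T. \<forall>s t. 0 \<le> s \<longrightarrow> s \<le> t \<longrightarrow> t \<le> T \<longrightarrow>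
       cmod (\<phi> s t \<zeta> - \<zeta>) \<le> (LINT \<xi>|lebesgue_on {s..t}. k \<xi>)"
  shows "displacement_controlled d T \<phi>"
proof (rule displacement_controlled_of_two_points[OF assms(1,2), of 0 "1 / 2"])
  show half: "(1 / 2 :: complex) \<in> unit_disc" by (simp add: norm_divide)
  fix \<zeta> :: complex assume "\<zeta> \<in> {0, 1 / 2}"
  then have "\<zeta> \<in> unit_disc" using half by (metis empty_iff insert_iff mem_ball_0 norm_zero zero_less_one)
  then show "\<exists>k\<in>nonneg_Ld d T. \<forall>s t. 0 \<le> s \<longrightarrow> s \<le> t \<longrightarrow> t \<le> T \<longrightarrow>
       cmod (\<phi> s t \<zeta> - \<zeta>) \<le> (LINT \<xi>|lebesgue_on {s..t}. k \<xi>)"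
    by (rule assms(3))
qed simp_all

lemma compact_subset_unit_disc:
  assumes "compact K" "K \<subseteq> unit_disc"
  obtains r where "0 \<le> r" "r < 1" "K \<subseteq> cball 0 r"
proof (cases "K = {}")
  case True then show thesis using that[of 0] by simp
next
  case False
  obtain x where x: "x \<in> K" "\<And>y. y \<in> K \<Longrightarrow> cmod y \<le> cmod x"
    using continuous_attains_sup[OF assms(1) False continuous_on_norm_id] by blast
  show thesis
  proof (rule that[of "cmod x"])
    show "cmod x < 1" using x assms(2) by auto
    show "K \<subseteq> cball 0 (cmod x)" using x by auto
  qed auto
qed

section \<open>Consequences of the functional equation\<close>

locale reverse_disc_flow =
  fixes \<phi> :: "real \<Rightarrow> real \<Rightarrow> complex \<Rightarrow> complex"
  assumes self_map: "disc_self_map_family \<phi>"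
    and refl: "0 \<le> s \<Longrightarrow> z \<in> unit_disc \<Longrightarrow> \<phi> s s z = z"
    and comp: "0 \<le> s \<Longrightarrow> s \<le> u \<Longrightarrow> u \<le> t \<Longrightarrow> z \<in> unit_disc \<Longrightarrow> \<phi> s t z = \<phi> s u (\<phi> u t z)"
begin

lemma self: "0 \<le> s \<Longrightarrow> s \<le> t \<Longrightarrow> disc_self_map (\<phi> s t)"
  using self_map by (simp add: disc_self_map_family_iff)

lemma in_disc: "0 \<le> s \<Longrightarrow> s \<le> t \<Longrightarrow> z \<in> unit_disc \<Longrightarrow> \<phi> s t z \<in> unit_disc"
  using disc_self_map_cmod[OF self] by simp

text \<open>By the functional equation \<open>\<phi> s t z - \<phi> s u z\<close> is the increment of the self-map \<open>\<phi> s u\<close> between \<open>\<phi> u t z\<close>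
  and \<open>z\<close>, and its Lipschitz constant at \<open>z\<close> depends on \<open>|z|\<close> alone.\<close>

lemma second_parameter_bound:
  assumes ctrl: "displacement_controlled d T \<phi>" and r: "0 \<le> r" "r < 1"
  obtains k where "k \<in> nonneg_Ld d T"
    "\<And>z s u t. z \<in> cball 0 r \<Longrightarrow> 0 \<le> s \<Longrightarrow> s \<le> u \<Longrightarrow> u \<le> t \<Longrightarrow> t \<le> T \<Longrightarrow>
       cmod (\<phi> s t z - \<phi> s u z) \<le> (LINT \<xi>|lebesgue_on {u..t}. k \<xi>)"
proof -
  obtain k where k: "k \<in> nonneg_Ld d T"
    "\<And>z s t. cmod z \<le> r \<Longrightarrow> 0 \<le> s \<Longrightarrow> s \<le> t \<Longrightarrow> t \<le> T \<Longrightarrow>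
       cmod (\<phi> s t z - z) \<le> (LINT \<xi>|lebesgue_on {s..t}. k \<xi>)"
    using displacement_controlledE[OF ctrl r] by blast
  let ?C = "2 / (1 - r)"
  show thesis
  proof (rule that[of "\<lambda>x. ?C * k x"])
    fix z :: complex and s u t assume z: "z \<in> cball 0 r" and sut: "0 \<le> s" "s \<le> u" "u \<le> t" "t \<le> T"
    have zd: "z \<in> unit_disc" using z r by simp
    have "cmod (\<phi> s t z - \<phi> s u z) = cmod (\<phi> s u (\<phi> u t z) - \<phi> s u z)"
      using comp sut zd by simp
    also have "\<dots> \<le> 2 / (1 - cmod z) * cmod (\<phi> u t z - z)"
      using disc_self_map_Lipschitz[OF self, of s u "\<phi> u t z" z] in_disc[of u t z] sut zd by simp
    also have "\<dots> \<le> ?C * (LINT \<xi>|lebesgue_on {u..t}. k \<xi>)"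
      using k(2)[of z u t] z sut r by (intro mult_mono divide_left_mono) auto
    finally show "cmod (\<phi> s t z - \<phi> s u z) \<le> (LINT \<xi>|lebesgue_on {u..t}. ?C * k \<xi>)" by simp
  qed (rule nonneg_Ld_scale, use k r in auto)
qed

text \<open>Over a short time interval the origin moves by at most \<open>1 / 2\<close>, which gives the bound with
  \<open>c = 1 / 4\<close>. Constants multiply under composition, so that a subdivision of \<open>[0, T]\<close> into finitely many
  short intervals (Bolzano's principle) yields a constant for all of it.\<close>

lemma boundary_distance_bound:
  assumes d: "1 \<le> d" and ctrl: "displacement_controlled d T \<phi>"
  obtains c where "0 < c" "\<And>u v z. 0 \<le> u \<Longrightarrow> u \<le> v \<Longrightarrow> v \<le> T \<Longrightarrow> cmod z < 1 \<Longrightarrow>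
    c * (1 - (cmod z)\<^sup>2) \<le> 1 - (cmod (\<phi> u v z))\<^sup>2"
proof -
  obtain k where k: "k \<in> nonneg_Ld d T"
    "\<And>z s t. cmod z \<le> 0 \<Longrightarrow> 0 \<le> s \<Longrightarrow> s \<le> t \<Longrightarrow> t \<le> T \<Longrightarrow>
       cmod (\<phi> s t z - z) \<le> (LINT \<xi>|lebesgue_on {s..t}. k \<xi>)"
    using displacement_controlledE[OF ctrl, of 0] by auto
  obtain \<delta> where \<delta>: "0 < \<delta>" "\<And>u t. 0 \<le> u \<Longrightarrow> u \<le> t \<Longrightarrow> t \<le> T \<Longrightarrow> t - u < \<delta> \<Longrightarrow>
      (LINT \<xi>|lebesgue_on {u..t}. k \<xi>) < 1 / 2"
    using nonneg_Ld_integral_small[OF d k(1), of "1/2"] by auto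
  \<comment> \<open>With \<open>c \<le> 1\<close> included, the product of the constants of two adjacent intervals also serves for times
    \<open>u\<close>, \<open>v\<close> that lie in one of them.\<close>
  define P where "P a b \<longleftrightarrow> (0 \<le> a \<longrightarrow> b \<le> T \<longrightarrow> (\<exists>c>0. c \<le> 1 \<and> (\<forall>u v z. a \<le> u \<longrightarrow> u \<le> v \<longrightarrow> v \<le> b \<longrightarrow>
      cmod z < 1 \<longrightarrow> c * (1 - (cmod z)\<^sup>2) \<le> 1 - (cmod (\<phi> u v z))\<^sup>2)))" for a b
  have "P 0 T" if "0 \<le> T"
    using that
  proof (induction rule: Bolzano)
    case (trans a b c)
    show ?case unfolding P_def
    proof (intro impI)
      assume "0 \<le> a" "c \<le> T"
      obtain c\<^sub>1 where c\<^sub>1: "0 < c\<^sub>1" "c\<^sub>1 \<le> 1" "\<And>u v z. a \<le> u \<Longrightarrow> u \<le> v \<Longrightarrow> v \<le> b \<Longrightarrow>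
          cmod z < 1 \<Longrightarrow> c\<^sub>1 * (1 - (cmod z)\<^sup>2) \<le> 1 - (cmod (\<phi> u v z))\<^sup>2"
        using trans \<open>0 \<le> a\<close> \<open>c \<le> T\<close> unfolding P_def by (meson order_trans)
      obtain c\<^sub>2 where c\<^sub>2: "0 < c\<^sub>2" "c\<^sub>2 \<le> 1" "\<And>u v z. b \<le> u \<Longrightarrow> u \<le> v \<Longrightarrow> v \<le> c \<Longrightarrow>
          cmod z < 1 \<Longrightarrow> c\<^sub>2 * (1 - (cmod z)\<^sup>2) \<le> 1 - (cmod (\<phi> u v z))\<^sup>2"
        using trans \<open>0 \<le> a\<close> \<open>c \<le> T\<close> unfolding P_def by (meson order_trans)
      have "c\<^sub>1 * c\<^sub>2 * (1 - (cmod z)\<^sup>2) \<le> 1 - (cmod (\<phi> u v z))\<^sup>2"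
        if uvz: "a \<le> u" "u \<le> v" "v \<le> c" "cmod z < 1" for u v z
      proof -
        have le: "c\<^sub>1 * c\<^sub>2 \<le> c\<^sub>1" "c\<^sub>1 * c\<^sub>2 \<le> c\<^sub>2"
          using c\<^sub>1 c\<^sub>2 by (auto simp: mult_left_le mult_left_le_one_le)
        have nn: "0 \<le> 1 - (cmod z)\<^sup>2" using uvz by (simp add: abs_square_le_1)
        consider "v \<le> b" | "b \<le> u" | "u \<le> b" "b \<le> v" by linarith
        then show ?thesis
        proof cases
          case 1
          then show ?thesis using c\<^sub>1(3)[of u v z] uvz mult_right_mono[OF le(1) nn] by linarith
        next
          case 2
          then show ?thesis using c\<^sub>2(3)[of u v z] uvz mult_right_mono[OF le(2) nn] by linarith
        next
          case 3
          have "c\<^sub>1 * c\<^sub>2 * (1 - (cmod z)\<^sup>2) \<le> c\<^sub>1 * (1 - (cmod (\<phi> b v z))\<^sup>2)"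
            using c\<^sub>2(3)[of b v z] 3 uvz c\<^sub>1(1) by (simp add: mult.assoc)
          also have "\<dots> \<le> 1 - (cmod (\<phi> u b (\<phi> b v z)))\<^sup>2"
            using c\<^sub>1(3)[of u b "\<phi> b v z"] 3 uvz in_disc[of b v z] \<open>0 \<le> a\<close> by simp
          also have "\<phi> u b (\<phi> b v z) = \<phi> u v z"
            using comp[of u b v z] 3 uvz \<open>0 \<le> a\<close> by simp
          finally show ?thesis .
        qed
      qed
      then show "\<exists>c'>0. c' \<le> 1 \<and> (\<forall>u v z. a \<le> u \<longrightarrow> u \<le> v \<longrightarrow> v \<le> c \<longrightarrow>
          cmod z < 1 \<longrightarrow> c' * (1 - (cmod z)\<^sup>2) \<le> 1 - (cmod (\<phi> u v z))\<^sup>2)"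
        using c\<^sub>1 c\<^sub>2 by (intro exI[of _ "c\<^sub>1 * c\<^sub>2"]) (auto simp: mult_le_one)
    qed
  next
    case (local x)
    show ?case
    proof (intro exI[of _ \<delta>] conjI allI impI \<delta>(1))
      fix a b assume ab: "a \<le> x \<and> x \<le> b \<and> b - a < \<delta>"
      show "P a b" unfolding P_def
      proof (intro impI exI[of _ "1 / 4 :: real"] conjI allI)
        fix u v z assume *: "0 \<le> a" "b \<le> T" "a \<le> u" "u \<le> v" "v \<le> b" "cmod z < 1"
        have "cmod (\<phi> u v 0) \<le> 1 / 2"
          using k(2)[of 0 u v] \<delta>(2)[of u v] * ab by simp
        then show "1 / 4 * (1 - (cmod z)\<^sup>2) \<le> 1 - (cmod (\<phi> u v z))\<^sup>2"
          using disc_self_map_boundary_distance[OF self, of u v z] * by simp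
      qed auto
    qed
  qed
  show thesis
  proof (cases "0 \<le> T")
    case True
    with \<open>0 \<le> T \<Longrightarrow> P 0 T\<close> that show thesis unfolding P_def by (metis order_refl)
  next
    case False then show thesis using that[of 1] by auto
  qed
qed

lemma uniformly_compact_images:
  assumes d: "1 \<le> d" and ctrl: "displacement_controlled d T \<phi>" and r: "0 \<le> r" "r < 1"
  obtains r' where "0 \<le> r'" "r' < 1"
    "\<And>u v z. 0 \<le> u \<Longrightarrow> u \<le> v \<Longrightarrow> v \<le> T \<Longrightarrow> cmod z \<le> r \<Longrightarrow> cmod (\<phi> u v z) \<le> r'"
proof -
  obtain c where c: "0 < c" "\<And>u v z. 0 \<le> u \<Longrightarrow> u \<le> v \<Longrightarrow> v \<le> T \<Longrightarrow> cmod z < 1 \<Longrightarrow>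
      c * (1 - (cmod z)\<^sup>2) \<le> 1 - (cmod (\<phi> u v z))\<^sup>2"
    using boundary_distance_bound[OF d ctrl] by blast
  define \<eta> where "\<eta> = min 1 (c * (1 - r\<^sup>2))"
  have \<eta>: "0 < \<eta>" "\<eta> \<le> 1" using c r by (auto simp: \<eta>_def abs_square_less_1)
  show thesis
  proof (rule that[of "sqrt (1 - \<eta>)"])
    fix u v z assume *: "0 \<le> u" "u \<le> v" "v \<le> T" "cmod z \<le> r"
    have "\<eta> \<le> c * (1 - r\<^sup>2)" by (simp add: \<eta>_def)
    also have "\<dots> \<le> c * (1 - (cmod z)\<^sup>2)" using c * by (intro mult_left_mono diff_left_mono power_mono) auto
    also have "\<dots> \<le> 1 - (cmod (\<phi> u v z))\<^sup>2" using c(2) * r by simp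
    finally show "cmod (\<phi> u v z) \<le> sqrt (1 - \<eta>)" by (intro real_le_rsqrt) simp
  qed (use \<eta> in auto)
qed

text \<open>By the functional equation \<open>\<phi> s t z - \<phi> u t z\<close> is the displacement of \<open>\<phi> u t z\<close> under \<open>\<phi> s u\<close>, and
  the points \<open>\<phi> u t z\<close> stay in a compact part of the disc.\<close>

lemma first_parameter_bound:
  assumes d: "1 \<le> d" and ctrl: "displacement_controlled d T \<phi>" and r: "0 \<le> r" "r < 1"
  obtains k where "k \<in> nonneg_Ld d T"
    "\<And>z s u t. z \<in> cball 0 r \<Longrightarrow> 0 \<le> s \<Longrightarrow> s \<le> u \<Longrightarrow> u \<le> t \<Longrightarrow> t \<le> T \<Longrightarrow>
       cmod (\<phi> s t z - \<phi> u t z) \<le> (LINT \<xi>|lebesgue_on {s..u}. k \<xi>)"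
proof -
  obtain r' where r': "0 \<le> r'" "r' < 1"
    "\<And>u v z. 0 \<le> u \<Longrightarrow> u \<le> v \<Longrightarrow> v \<le> T \<Longrightarrow> cmod z \<le> r \<Longrightarrow> cmod (\<phi> u v z) \<le> r'"
    using uniformly_compact_images[OF d ctrl r] by blast
  obtain k where k: "k \<in> nonneg_Ld d T"
    "\<And>z s t. cmod z \<le> r' \<Longrightarrow> 0 \<le> s \<Longrightarrow> s \<le> t \<Longrightarrow> t \<le> T \<Longrightarrow>
       cmod (\<phi> s t z - z) \<le> (LINT \<xi>|lebesgue_on {s..t}. k \<xi>)"
    using displacement_controlledE[OF ctrl r'(1,2)] by blast
  show thesis
  proof (rule that[OF k(1)])
    fix z :: complex and s u t assume z: "z \<in> cball 0 r" and sut: "0 \<le> s" "s \<le> u" "u \<le> t" "t \<le> T"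
    have "\<phi> s t z = \<phi> s u (\<phi> u t z)" using comp sut z r by simp
    then show "cmod (\<phi> s t z - \<phi> u t z) \<le> (LINT \<xi>|lebesgue_on {s..u}. k \<xi>)"
      using k(2)[of "\<phi> u t z" s u] r'(3)[of u t z] z sut by simp
  qed
qed

text \<open>Follow two trajectories \<open>a \<mapsto> \<phi> a t x\<close> and \<open>a \<mapsto> \<phi> a t y\<close> backwards from \<open>a = t\<close>. They stay in a fixed
  disc of radius \<open>r' < 1\<close>, and on it \<open>\<phi> a b\<close> is injective whenever \<open>b - a\<close> is small, being close to
  the identity on a slightly larger disc. So points distinct at time \<open>b\<close> are distinct at time \<open>a\<close>; by
  Bolzano's principle this passes from short intervals to \<open>[s, t]\<close>.\<close>

lemma flow_inj_on:
  assumes d: "1 \<le> d" and ctrl: "displacement_controlled d T \<phi>" and st: "0 \<le> s" "s \<le> t" "t \<le> T"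
  shows "inj_on (\<phi> s t) unit_disc"
proof (rule inj_onI, rule ccontr)
  fix x y assume xy: "x \<in> unit_disc" "y \<in> unit_disc" "\<phi> s t x = \<phi> s t y" "x \<noteq> y"
  define r where "r = max (cmod x) (cmod y)"
  have r: "0 \<le> r" "r < 1" "cmod x \<le> r" "cmod y \<le> r" using xy by (auto simp: r_def le_max_iff_disj)
  obtain r' where r': "0 \<le> r'" "r' < 1"
    "\<And>u v z. 0 \<le> u \<Longrightarrow> u \<le> v \<Longrightarrow> v \<le> T \<Longrightarrow> cmod z \<le> r \<Longrightarrow> cmod (\<phi> u v z) \<le> r'"
    using uniformly_compact_images[OF d ctrl r(1,2)] by blast
  define \<rho> where "\<rho> = (1 + r') / 2"
  have \<rho>: "0 \<le> \<rho>" "\<rho> < 1" "r' < \<rho>" using r' by (auto simp: \<rho>_def)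
  obtain k where k: "k \<in> nonneg_Ld d T"
    "\<And>z s t. cmod z \<le> \<rho> \<Longrightarrow> 0 \<le> s \<Longrightarrow> s \<le> t \<Longrightarrow> t \<le> T \<Longrightarrow>
       cmod (\<phi> s t z - z) \<le> (LINT \<xi>|lebesgue_on {s..t}. k \<xi>)"
    using displacement_controlledE[OF ctrl \<rho>(1,2)] by blast
  define \<epsilon> where "\<epsilon> = (\<rho> - r') / 4"
  have \<epsilon>: "0 < \<epsilon>" "2 * \<epsilon> < \<rho> - r'" using \<rho> by (auto simp: \<epsilon>_def)
  obtain \<delta> where \<delta>: "0 < \<delta>" "\<And>u t. 0 \<le> u \<Longrightarrow> u \<le> t \<Longrightarrow> t \<le> T \<Longrightarrow> t - u < \<delta> \<Longrightarrow>
      (LINT \<xi>|lebesgue_on {u..t}. k \<xi>) < \<epsilon>"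
    using nonneg_Ld_integral_small[OF d k(1) \<epsilon>(1)] by blast
  define P where "P a b \<longleftrightarrow> (s \<le> a \<longrightarrow> a \<le> b \<longrightarrow> b \<le> t \<longrightarrow> \<phi> b t x \<noteq> \<phi> b t y \<longrightarrow> \<phi> a t x \<noteq> \<phi> a t y)" for a b
  have "P s t" using st(2)
  proof (induction rule: Bolzano)
    case (trans a b c) then show ?case by (auto simp: P_def)
  next
    case (local p)
    show ?case
    proof (intro exI[of _ \<delta>] conjI allI impI \<delta>(1))
      fix a b assume ab: "a \<le> p \<and> p \<le> b \<and> b - a < \<delta>"
      show "P a b" unfolding P_def
      proof (intro impI)
        assume *: "s \<le> a" "a \<le> b" "b \<le> t" "\<phi> b t x \<noteq> \<phi> b t y"
        have "inj_on (\<phi> a b) (cball 0 r')"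
        proof (rule near_identity_injective[OF _ r'(1) \<rho>(3) \<epsilon>])
          show "\<phi> a b holomorphic_on ball 0 \<rho>"
            using self[of a b] * st \<rho> unfolding disc_self_map_def
            by (auto elim!: holomorphic_on_subset)
          show "cmod (\<phi> a b z - z) < \<epsilon>" if "cmod z < \<rho>" for z
            using k(2)[of z a b] \<delta>(2)[of a b] that * st ab by simp
        qed
        moreover have "\<phi> b t x \<in> cball 0 r'" "\<phi> b t y \<in> cball 0 r'"
          using r'(3)[of b t] r * st by auto
        ultimately have "\<phi> a b (\<phi> b t x) \<noteq> \<phi> a b (\<phi> b t y)"
          using * by (metis inj_on_eq_iff)
        then show "\<phi> a t x \<noteq> \<phi> a t y" using comp[of a b t] * st xy by simp
      qed
    qed
  qed
  then show False using st xy refl[of t] by (simp add: P_def)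
qed

text \<open>Reversing time turns the functional equation of a reverse evolution family into that of an evolution
  family. The family thus obtained lives on \<open>[0, T]\<close>; clamping the reversed times at \<open>0\<close> prolongs it by letting
  the motion stop at time \<open>T\<close>.\<close>

lemma time_reversal_evolution_family:
  assumes d: "1 \<le> d" and ctrl: "displacement_controlled d T \<phi>" and "0 \<le> T"
  shows "evolution_family d (\<lambda>s t. \<phi> (max 0 (T - t)) (max 0 (T - s)))"
  unfolding evolution_family_def
proof (intro conjI allI impI ballI)
  show "disc_self_map_family (\<lambda>s t. \<phi> (max 0 (T - t)) (max 0 (T - s)))"
    unfolding disc_self_map_family_iff by (auto intro: self)
next
  fix z :: complex and T' :: real assume z: "z \<in> unit_disc"
  obtain k where k: "k \<in> nonneg_Ld d T"
    "\<And>x s u t. x \<in> cball 0 (cmod z) \<Longrightarrow> 0 \<le> s \<Longrightarrow> s \<le> u \<Longrightarrow> u \<le> t \<Longrightarrow> t \<le> T \<Longrightarrow>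
       cmod (\<phi> s t x - \<phi> u t x) \<le> (LINT \<xi>|lebesgue_on {s..u}. k \<xi>)"
    using first_parameter_bound[OF d ctrl, of "cmod z"] z by auto
  obtain m where m: "m \<in> nonneg_Ld d T'"
    "\<And>u t. 0 \<le> u \<Longrightarrow> u \<le> t \<Longrightarrow> t \<le> T' \<Longrightarrow>
       (LINT \<xi>|lebesgue_on {max 0 (T - t)..max 0 (T - u)}. k \<xi>) \<le> (LINT \<xi>|lebesgue_on {u..t}. m \<xi>)"
    using nonneg_Ld_reflect[OF d k(1)] by blast
  show "\<exists>k\<in>nonneg_Ld d T'. \<forall>s u t. 0 \<le> s \<longrightarrow> s \<le> u \<longrightarrow> u \<le> t \<longrightarrow> t \<le> T' \<longrightarrow>
      cmod (\<phi> (max 0 (T - u)) (max 0 (T - s)) z - \<phi> (max 0 (T - t)) (max 0 (T - s)) z)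
        \<le> (LINT \<xi>|lebesgue_on {u..t}. k \<xi>)"
  proof (intro bexI[OF _ m(1)] allI impI)
    fix s u t assume sut: "0 \<le> s" "s \<le> u" "u \<le> t" "t \<le> T'"
    have "cmod (\<phi> (max 0 (T - t)) (max 0 (T - s)) z - \<phi> (max 0 (T - u)) (max 0 (T - s)) z)
        \<le> (LINT \<xi>|lebesgue_on {max 0 (T - t)..max 0 (T - u)}. k \<xi>)"
      using sut \<open>0 \<le> T\<close> by (intro k(2)) auto
    also have "\<dots> \<le> (LINT \<xi>|lebesgue_on {u..t}. m \<xi>)" using sut by (intro m(2)) auto
    finally show "cmod (\<phi> (max 0 (T - u)) (max 0 (T - s)) z - \<phi> (max 0 (T - t)) (max 0 (T - s)) z)
        \<le> (LINT \<xi>|lebesgue_on {u..t}. m \<xi>)" by (simp add: norm_minus_commute)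
  qed
qed (auto intro!: refl comp)

end

section \<open>Evolution families and reverse evolution families\<close>

text \<open>The map \<open>\<psi> (T - t) (T - t)\<close> is the identity, so regularity of \<open>\<psi>\<close> in its second parameter
  bounds the displacement of \<open>\<psi> (T - t) (T - s)\<close>, which is \<open>\<phi> s t\<close>.\<close>

lemma displacement_controlled_of_time_reversal:
  assumes d: "1 \<le> d" and \<phi>: "disc_self_map_family \<phi>" and "0 < T"
    and \<psi>: "evolution_family d \<psi>"
    and rev: "\<And>s t z. 0 \<le> s \<Longrightarrow> s \<le> t \<Longrightarrow> t \<le> T \<Longrightarrow> z \<in> unit_disc \<Longrightarrow> \<phi> s t z = \<psi> (T - t) (T - s) z"
  shows "displacement_controlled d T \<phi>"
proof (rule displacement_controlled_of_pointwise[OF d \<phi>])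
  fix \<zeta> :: complex assume \<zeta>: "\<zeta> \<in> unit_disc"
  obtain k where k: "k \<in> nonneg_Ld d T" "\<And>s u t. 0 \<le> s \<Longrightarrow> s \<le> u \<Longrightarrow> u \<le> t \<Longrightarrow> t \<le> T \<Longrightarrow>
      cmod (\<psi> s u \<zeta> - \<psi> s t \<zeta>) \<le> (LINT \<xi>|lebesgue_on {u..t}. k \<xi>)"
    using \<psi> \<zeta> \<open>0 < T\<close> unfolding evolution_family_def by metis
  obtain m where m: "m \<in> nonneg_Ld d T"
    "\<And>u t. 0 \<le> u \<Longrightarrow> u \<le> t \<Longrightarrow> t \<le> T \<Longrightarrow>
       (LINT \<xi>|lebesgue_on {max 0 (T - t)..max 0 (T - u)}. k \<xi>) \<le> (LINT \<xi>|lebesgue_on {u..t}. m \<xi>)"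
    using nonneg_Ld_reflect[OF d k(1)] by blast
  show "\<exists>k\<in>nonneg_Ld d T. \<forall>s t. 0 \<le> s \<longrightarrow> s \<le> t \<longrightarrow> t \<le> T \<longrightarrow>
      cmod (\<phi> s t \<zeta> - \<zeta>) \<le> (LINT \<xi>|lebesgue_on {s..t}. k \<xi>)"
  proof (intro bexI[OF _ m(1)] allI impI)
    fix s t assume st: "0 \<le> s" "s \<le> t" "t \<le> T"
    have "\<psi> (T - t) (T - t) \<zeta> = \<zeta>" using \<psi> \<zeta> st by (simp add: evolution_family_def)
    then have "cmod (\<phi> s t \<zeta> - \<zeta>) = cmod (\<psi> (T - t) (T - t) \<zeta> - \<psi> (T - t) (T - s) \<zeta>)"
      using rev st \<zeta> by (simp add: norm_minus_commute)
    also have "\<dots> \<le> (LINT \<xi>|lebesgue_on {max 0 (T - t)..max 0 (T - s)}. k \<xi>)"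
      using k(2)[of "T - t" "T - t" "T - s"] st by simp
    also have "\<dots> \<le> (LINT \<xi>|lebesgue_on {s..t}. m \<xi>)" using st by (intro m(2))
    finally show "cmod (\<phi> s t \<zeta> - \<zeta>) \<le> (LINT \<xi>|lebesgue_on {s..t}. m \<xi>)" .
  qed
qed

lemma reverse_evolution_family_displacement_controlled:
  assumes d: "1 \<le> d" and \<omega>: "reverse_evolution_family d \<omega>" and "0 < T"
  shows "displacement_controlled d T \<omega>"
proof (rule displacement_controlled_of_pointwise[OF d])
  show "disc_self_map_family \<omega>" using \<omega> by (simp add: reverse_evolution_family_def)
  fix \<zeta> :: complex assume \<zeta>: "\<zeta> \<in> unit_disc"
  obtain k where k: "k \<in> nonneg_Ld d T" "\<And>s u t. 0 \<le> s \<Longrightarrow> s \<le> u \<Longrightarrow> u \<le> t \<Longrightarrow> t \<le> T \<Longrightarrow>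
      cmod (\<omega> s u \<zeta> - \<omega> s t \<zeta>) \<le> (LINT \<xi>|lebesgue_on {u..t}. k \<xi>)"
    using \<omega> \<zeta> \<open>0 < T\<close> unfolding reverse_evolution_family_def by metis
  have "\<omega> s s \<zeta> = \<zeta>" if "0 \<le> s" for s
    using \<omega> \<zeta> that by (simp add: reverse_evolution_family_def)
  then show "\<exists>k\<in>nonneg_Ld d T. \<forall>s t. 0 \<le> s \<longrightarrow> s \<le> t \<longrightarrow> t \<le> T \<longrightarrow>
      cmod (\<omega> s t \<zeta> - \<zeta>) \<le> (LINT \<xi>|lebesgue_on {s..t}. k \<xi>)"
    using k by (intro bexI[OF _ k(1)]) (metis norm_minus_commute order_refl)
qed

lemma reverse_evolution_family_inj_on:
  assumes d: "1 \<le> d" and \<omega>: "reverse_evolution_family d \<omega>" and st: "0 \<le> s" "s \<le> t"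
  shows "inj_on (\<omega> s t) unit_disc"
proof -
  interpret reverse_disc_flow \<omega>
    using \<omega> unfolding reverse_evolution_family_def by unfold_locales blast+
  have "displacement_controlled d (t + 1) \<omega>"
    using st by (intro reverse_evolution_family_displacement_controlled[OF d \<omega>]) auto
  then show ?thesis using st by (intro flow_inj_on[OF d]) auto
qed

theorem proposition4p3:
  fixes d :: ereal and \<phi> :: "real \<Rightarrow> real \<Rightarrow> complex \<Rightarrow> complex"
  assumes "1 \<le> d"
    and "disc_self_map_family \<phi>"
    and "\<forall>s\<ge>0. \<forall>z\<in>unit_disc. \<phi> s s z = z"
    and "\<forall>s u t. 0 \<le> s \<longrightarrow> s \<le> u \<longrightarrow> u \<le> t \<longrightarrow> (\<forall>z\<in>unit_disc. \<phi> s t z = \<phi> s u (\<phi> u t z))"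
  shows
    "((\<forall>T>0. \<exists>\<zeta>\<^sub>1\<in>unit_disc. \<exists>\<zeta>\<^sub>2\<in>unit_disc. \<zeta>\<^sub>1 \<noteq> \<zeta>\<^sub>2 \<and> (\<exists>k\<in>nonneg_Ld d T.
         \<forall>\<zeta>\<in>{\<zeta>\<^sub>1, \<zeta>\<^sub>2}. \<forall>s u t. 0 \<le> s \<longrightarrow> s \<le> u \<longrightarrow> u \<le> t \<longrightarrow> t \<le> T \<longrightarrow>
           norm (\<phi> s t \<zeta> - \<phi> s u \<zeta>) \<le> (LINT \<xi>|lebesgue_on {u..t}. k \<xi>)))
       \<longleftrightarrow> reverse_evolution_family d \<phi>) \<and>
     ((\<forall>T>0. \<forall>K. compact K \<longrightarrow> K \<subseteq> unit_disc \<longrightarrow> (\<exists>k\<in>nonneg_Ld d T.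
         \<forall>z\<in>K. \<forall>s u t. 0 \<le> s \<longrightarrow> s \<le> u \<longrightarrow> u \<le> t \<longrightarrow> t \<le> T \<longrightarrow>
           norm (\<phi> s t z - \<phi> s u z) \<le> (LINT \<xi>|lebesgue_on {u..t}. k \<xi>)))
       \<longleftrightarrow> reverse_evolution_family d \<phi>) \<and>
     ((\<forall>T>0. \<exists>\<psi>. evolution_family d \<psi> \<and>
         (\<forall>s t. 0 \<le> s \<longrightarrow> s \<le> t \<longrightarrow> t \<le> T \<longrightarrow>
           (\<forall>z\<in>unit_disc. \<phi> s t z = \<psi> (T - t) (T - s) z)))
       \<longleftrightarrow> reverse_evolution_family d \<phi>) \<and>
     ((\<forall>T>0. \<forall>K. compact K \<longrightarrow> K \<subseteq> unit_disc \<longrightarrow> (\<exists>k\<in>nonneg_Ld d T.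
         \<forall>z\<in>K. \<forall>s u t. 0 \<le> s \<longrightarrow> s \<le> u \<longrightarrow> u \<le> t \<longrightarrow> t \<le> T \<longrightarrow>
           norm (\<phi> s t z - \<phi> u t z) \<le> (LINT \<xi>|lebesgue_on {s..u}. k \<xi>)))
       \<longleftrightarrow> reverse_evolution_family d \<phi>) \<and>
     (\<forall>\<omega>. reverse_evolution_family d \<omega> \<longrightarrow>
        (\<forall>s t. 0 \<le> s \<longrightarrow> s \<le> t \<longrightarrow>
           \<omega> s t holomorphic_on unit_disc \<and> inj_on (\<omega> s t) unit_disc))"
    (is "(?i \<longleftrightarrow> ?ii) \<and> (?iii \<longleftrightarrow> ?ii) \<and> (?iv \<longleftrightarrow> ?ii) \<and> (?v \<longleftrightarrow> ?ii) \<and> ?univalent")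
proof -
  note d = assms(1) and \<phi> = assms(2)
  interpret reverse_disc_flow \<phi>
    using assms by unfold_locales blast+
  let ?C = "\<forall>T>0. displacement_controlled d T \<phi>"
  have half: "(1 / 2 :: complex) \<in> unit_disc" by (simp add: norm_divide)

  have iii: ?iii if C: ?C
  proof (intro allI impI)
    fix T :: real and K assume "0 < T" "compact K" "K \<subseteq> unit_disc"
    obtain r where r: "0 \<le> r" "r < 1" "K \<subseteq> cball 0 r"
      using compact_subset_unit_disc \<open>compact K\<close> \<open>K \<subseteq> unit_disc\<close> by blast
    obtain k where "k \<in> nonneg_Ld d T"
      "\<And>z s u t. z \<in> cball 0 r \<Longrightarrow> 0 \<le> s \<Longrightarrow> s \<le> u \<Longrightarrow> u \<le> t \<Longrightarrow> t \<le> T \<Longrightarrow>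
         cmod (\<phi> s t z - \<phi> s u z) \<le> (LINT \<xi>|lebesgue_on {u..t}. k \<xi>)"
      using second_parameter_bound[OF C[rule_format, OF \<open>0 < T\<close>] r(1,2)] by blast
    then show "\<exists>k\<in>nonneg_Ld d T. \<forall>z\<in>K. \<forall>s u t. 0 \<le> s \<longrightarrow> s \<le> u \<longrightarrow> u \<le> t \<longrightarrow> t \<le> T \<longrightarrow>
        cmod (\<phi> s t z - \<phi> s u z) \<le> (LINT \<xi>|lebesgue_on {u..t}. k \<xi>)"
      using r(3) by (meson subsetD)
  qed
  have v: ?v if C: ?C
  proof (intro allI impI)
    fix T :: real and K assume "0 < T" "compact K" "K \<subseteq> unit_disc"
    obtain r where r: "0 \<le> r" "r < 1" "K \<subseteq> cball 0 r"
      using compact_subset_unit_disc \<open>compact K\<close> \<open>K \<subseteq> unit_disc\<close> by blast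
    obtain k where "k \<in> nonneg_Ld d T"
      "\<And>z s u t. z \<in> cball 0 r \<Longrightarrow> 0 \<le> s \<Longrightarrow> s \<le> u \<Longrightarrow> u \<le> t \<Longrightarrow> t \<le> T \<Longrightarrow>
         cmod (\<phi> s t z - \<phi> u t z) \<le> (LINT \<xi>|lebesgue_on {s..u}. k \<xi>)"
      using first_parameter_bound[OF d C[rule_format, OF \<open>0 < T\<close>] r(1,2)] by blast
    then show "\<exists>k\<in>nonneg_Ld d T. \<forall>z\<in>K. \<forall>s u t. 0 \<le> s \<longrightarrow> s \<le> u \<longrightarrow> u \<le> t \<longrightarrow> t \<le> T \<longrightarrow>
        cmod (\<phi> s t z - \<phi> u t z) \<le> (LINT \<xi>|lebesgue_on {s..u}. k \<xi>)"
      using r(3) by (meson subsetD)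
  qed
  have iii_ii: ?ii if iii: ?iii
    unfolding reverse_evolution_family_def
  proof (intro conjI ballI allI impI)
    fix z :: complex and T :: real assume "z \<in> unit_disc" "0 < T"
    then have "compact {z}" "{z} \<subseteq> unit_disc" by auto
    from iii[rule_format, OF \<open>0 < T\<close> this]
    show "\<exists>k\<in>nonneg_Ld d T. \<forall>s u t. 0 \<le> s \<longrightarrow> s \<le> u \<longrightarrow> u \<le> t \<longrightarrow> t \<le> T \<longrightarrow>
        cmod (\<phi> s u z - \<phi> s t z) \<le> (LINT \<xi>|lebesgue_on {u..t}. k \<xi>)"
      by (simp add: norm_minus_commute)
  qed (use assms in blast)+
  have iii_i: ?i if iii: ?iii
  proof (intro allI impI)
    fix T :: real assume "0 < T"
    have "compact {0, 1 / 2 :: complex}" "{0, 1 / 2 :: complex} \<subseteq> unit_disc" using half by auto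
    note bound = iii[rule_format, OF \<open>0 < T\<close> this]
    show "\<exists>\<zeta>\<^sub>1\<in>unit_disc. \<exists>\<zeta>\<^sub>2\<in>unit_disc. \<zeta>\<^sub>1 \<noteq> \<zeta>\<^sub>2 \<and> (\<exists>k\<in>nonneg_Ld d T.
        \<forall>\<zeta>\<in>{\<zeta>\<^sub>1, \<zeta>\<^sub>2}. \<forall>s u t. 0 \<le> s \<longrightarrow> s \<le> u \<longrightarrow> u \<le> t \<longrightarrow> t \<le> T \<longrightarrow>
          cmod (\<phi> s t \<zeta> - \<phi> s u \<zeta>) \<le> (LINT \<xi>|lebesgue_on {u..t}. k \<xi>))"
      by (intro bexI[of _ 0] bexI[of _ "1 / 2"] conjI bound half) simp_all
  qed
  have iv: ?iv if ?C
  proof (intro allI impI)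
    fix T :: real assume "0 < T"
    let ?\<psi> = "\<lambda>s t. \<phi> (max 0 (T - t)) (max 0 (T - s))"
    have "evolution_family d ?\<psi>"
      using that \<open>0 < T\<close> by (intro time_reversal_evolution_family[OF d]) auto
    then show "\<exists>\<psi>. evolution_family d \<psi> \<and> (\<forall>s t. 0 \<le> s \<longrightarrow> s \<le> t \<longrightarrow> t \<le> T \<longrightarrow>
        (\<forall>z\<in>unit_disc. \<phi> s t z = \<psi> (T - t) (T - s) z))"
      by (intro exI[of _ ?\<psi>]) simp
  qed
  have i_C: ?C if i: ?i
  proof (intro allI impI)
    fix T :: real assume "0 < T"
    from i[rule_format, OF this] obtain \<zeta>\<^sub>1 \<zeta>\<^sub>2 k where \<zeta>: "\<zeta>\<^sub>1 \<in> unit_disc" "\<zeta>\<^sub>2 \<in> unit_disc" "\<zeta>\<^sub>1 \<noteq> \<zeta>\<^sub>2"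
      and k: "k \<in> nonneg_Ld d T" "\<And>\<zeta> s u t. \<zeta> \<in> {\<zeta>\<^sub>1, \<zeta>\<^sub>2} \<Longrightarrow> 0 \<le> s \<Longrightarrow> s \<le> u \<Longrightarrow> u \<le> t \<Longrightarrow> t \<le> T \<Longrightarrow>
          cmod (\<phi> s t \<zeta> - \<phi> s u \<zeta>) \<le> (LINT \<xi>|lebesgue_on {u..t}. k \<xi>)"
      by meson
    show "displacement_controlled d T \<phi>"
    proof (rule displacement_controlled_of_two_points[OF d \<phi> \<zeta>], intro bexI[OF _ k(1)] allI impI)
      fix \<zeta> s t assume *: "\<zeta> \<in> {\<zeta>\<^sub>1, \<zeta>\<^sub>2}" "0 \<le> s" "s \<le> t" "t \<le> T"
      have "\<phi> s s \<zeta> = \<zeta>" using refl * \<zeta> by auto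
      then show "cmod (\<phi> s t \<zeta> - \<zeta>) \<le> (LINT \<xi>|lebesgue_on {s..t}. k \<xi>)"
        using k(2)[of \<zeta> s s t] * by simp
    qed
  qed
  have iv_C: ?C if iv: ?iv
  proof (intro allI impI)
    fix T :: real assume "0 < T"
    from iv[rule_format, OF this] obtain \<psi> where "evolution_family d \<psi>"
      "\<And>s t z. 0 \<le> s \<Longrightarrow> s \<le> t \<Longrightarrow> t \<le> T \<Longrightarrow> z \<in> unit_disc \<Longrightarrow> \<phi> s t z = \<psi> (T - t) (T - s) z"
      by meson
    then show "displacement_controlled d T \<phi>"
      by (rule displacement_controlled_of_time_reversal[OF d \<phi> \<open>0 < T\<close>])
  qed
  have v_C: ?C if v: ?v
  proof (intro allI impI)
    fix T :: real assume "0 < T"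
    show "displacement_controlled d T \<phi>"
    proof (rule displacement_controlled_of_pointwise[OF d \<phi>])
      fix \<zeta> :: complex assume \<zeta>: "\<zeta> \<in> unit_disc"
      then have "compact {\<zeta>}" "{\<zeta>} \<subseteq> unit_disc" by auto
      from v[rule_format, OF \<open>0 < T\<close> this] obtain k where k: "k \<in> nonneg_Ld d T"
        "\<And>s u t. 0 \<le> s \<Longrightarrow> s \<le> u \<Longrightarrow> u \<le> t \<Longrightarrow> t \<le> T \<Longrightarrow>
           cmod (\<phi> s t \<zeta> - \<phi> u t \<zeta>) \<le> (LINT \<xi>|lebesgue_on {s..u}. k \<xi>)"
        by auto
      show "\<exists>k\<in>nonneg_Ld d T. \<forall>s t. 0 \<le> s \<longrightarrow> s \<le> t \<longrightarrow> t \<le> T \<longrightarrow>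
          cmod (\<phi> s t \<zeta> - \<zeta>) \<le> (LINT \<xi>|lebesgue_on {s..t}. k \<xi>)"
      proof (intro bexI[OF _ k(1)] allI impI)
        fix s t assume *: "0 \<le> s" "s \<le> t" "t \<le> T"
        have "\<phi> t t \<zeta> = \<zeta>" using refl * \<zeta> by auto
        then show "cmod (\<phi> s t \<zeta> - \<zeta>) \<le> (LINT \<xi>|lebesgue_on {s..t}. k \<xi>)"
          using k(2)[of s t t] * by simp
      qed
    qed
  qed
  have ii_C: ?C if ?ii
    using reverse_evolution_family_displacement_controlled[OF d that] by simp
  have univalent: ?univalent
  proof (intro allI impI conjI reverse_evolution_family_inj_on[OF d])
    fix \<omega> and s t :: real assume "reverse_evolution_family d \<omega>" "0 \<le> s" "s \<le> t"
    then show "\<omega> s t holomorphic_on unit_disc"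
      unfolding reverse_evolution_family_def disc_self_map_family_def by metis
  qed

  \<comment> \<open>The arrows into and out of \<open>?C\<close> combine to the equivalences; \<open>?ii\<close> and \<open>?i\<close> are reached from \<open>?C\<close> through \<open>?iii\<close>.\<close>
  have "?i \<longleftrightarrow> ?ii" by (rule iffI[OF iii_ii[OF iii[OF i_C]] iii_i[OF iii[OF ii_C]]])
  moreover have "?iii \<longleftrightarrow> ?ii" by (rule iffI[OF iii_ii iii[OF ii_C]])
  moreover have "?iv \<longleftrightarrow> ?ii" by (rule iffI[OF iii_ii[OF iii[OF iv_C]] iv[OF ii_C]])
  moreover have "?v \<longleftrightarrow> ?ii" by (rule iffI[OF iii_ii[OF iii[OF v_C]] v[OF ii_C]])
  ultimately show ?thesis using univalent by (intro conjI)
qed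

end
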